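(* There are universal constants $c,C>0$ such that the following holds. Let $\Pi$ be a finite class of $N\ge2$ simulatable causal policies, let $K_0$ satisfy $\Lambda(K_0)<\infty$, and let $e_1=x_1-\bar x_1=0$. Assume $\sup_{t\le T}\sup_{\pi,\pi'\in\Pi}\|y_t^\pi-y_t^{\pi'}\|\le\Delta$ and that for every $t$ the cost $c_t$ is convex and $L$-Lipschitz on the convex hull of the physical point $y_t$ and $\{y_t^\pi:\pi\in\Pi\}$. Then Gibbs counterfactual tracking with the uniform prior on $\Pi$ and a suitable learning rate $\eta>0$ (depending only on $L,\Delta,\Gamma_{\rm tr},T,N$ and satisfying $\eta L\Delta\le c$) satisfies $$\mathrm{Reg}_T(\Pi)\le CL\Delta\left[\sqrt{\Gamma_{\rm tr}T\log N}+\log N\right].$$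
   Context: Model: $A\in\mathbb R^{d_x\times d_x}$, $B\in\mathbb R^{d_x\times d_u}$ are known; $x_1=0$ and $x_{t+1}=Ax_t+Bu_t+w_t$ with $\|w_t\|\le W$. On round $t=1,\dots,T$ the learner observes $x_t$, chooses $u_t$, incurs $c_t(x_t,u_t)$, then observes the whole function $c_t$ and $x_{t+1}$ (hence $w_t$). The environment may choose $c_t,w_t$ as a function of previously revealed history but not of the current action. The bound is pathwise. Write $y_t=(x_t,u_t)$. Policies: a causal policy $\pi$ chooses its action from its own state and the previously revealed costs and disturbances. Its counterfactual trajectory $y_t^\pi=(x_t^\pi,u_t^\pi)$ is obtained by running $\pi$ from $x_1^\pi=0$ on the same realized $(c_t,w_t)$: $x_{t+1}^\pi=Ax_t^\pi+Bu_t^\pi+w_t$. Simulatable: after round $t$ its next state and action can be computed from the revealed history. $\mathrm{Reg}_T(\Pi)=\sum_{t=1}^Tc_t(y_t)-\inf_{\pi\in\Pi}\sum_{t=1}^Tc_t(y_t^\pi)$. Gibbs counterfactual tracking with uniform prior: $p_t(\pi)\propto\exp\{-\eta\sum_{s<t}c_s(y_s^\pi)\}$ on $\Pi$, $\bar y_t=(\bar x_t,\bar u_t)=\sum_{\pi\in\Pi}p_t(\pi)y_t^\pi$, and the physical action is $u_t=\bar u_t-K_0(x_t-\bar x_t)$. Norms: $\|\cdot\|$ Euclidean, $\|(x,u)\|^2=\|x\|^2+\|u\|^2$. With $F_0=A-BK_0$: $\Lambda(K_0)=\sum_{r\ge0}\left\|\begin{bmatrix}I\\-K_0\end{bmatrix}F_0^r\right\|_{\rm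 op}$, $B_+=\|[A\ B]\|_{\rm op}$, $\Gamma_{\rm tr}=1+\Lambda(K_0)B_+$. *)

theory Defs
  imports
    "Jordan_Normal_Form.Matrix"
    "HOL-Analysis.L2_Norm"
    "HOL-Library.Extended_Nonnegative_Real"
    "HOL.Hull"
begin

text \<open>
  The universal constants of the theorem must not depend on the dimensions, so the dimensions
  are natural numbers rather than types: vectors and matrices are those of
  \<^theory>\<open>Jordan_Normal_Form.Matrix\<close>, with explicit carriers.  These types are not normed vector
  spaces, hence Euclidean norm, operator norm, convexity and the Lipschitz property are spelled out
  below exactly as the type-class versions of HOL-Analysis define them.
\<close>

definition vec_norm2 :: "real vec \<Rightarrow> real" where
  "vec_norm2 v = L2_set (\<lambda>i. v $ i) {..<dim_vec v}"

definition op_norm :: "real mat \<Rightarrow> real" where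
  "op_norm M = (SUP v\<in>{v \<in> carrier_vec (dim_col M). vec_norm2 v \<le> 1}. vec_norm2 (M *\<^sub>v v))"

definition vec_convex :: "nat \<Rightarrow> real vec set \<Rightarrow> bool" where
  "vec_convex n S \<longleftrightarrow> S \<subseteq> carrier_vec n \<and>
     (\<forall>x\<in>S. \<forall>y\<in>S. \<forall>a\<ge>0. \<forall>b\<ge>0. a + b = 1 \<longrightarrow> a \<cdot>\<^sub>v x + b \<cdot>\<^sub>v y \<in> S)"

definition vec_convex_hull :: "nat \<Rightarrow> real vec set \<Rightarrow> real vec set" where
  "vec_convex_hull n S = vec_convex n hull S"

definition vec_convex_on :: "nat \<Rightarrow> real vec set \<Rightarrow> (real vec \<Rightarrow> real) \<Rightarrow> bool" where
  "vec_convex_on n S f \<longleftrightarrow> vec_convex n S \<and>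
     (\<forall>x\<in>S. \<forall>y\<in>S. \<forall>a\<ge>0. \<forall>b\<ge>0. a + b = 1 \<longrightarrow>
        f (a \<cdot>\<^sub>v x + b \<cdot>\<^sub>v y) \<le> a * f x + b * f y)"

definition vec_lipschitz_on :: "real \<Rightarrow> real vec set \<Rightarrow> (real vec \<Rightarrow> real) \<Rightarrow> bool" where
  "vec_lipschitz_on L S f \<longleftrightarrow> 0 \<le> L \<and>
     (\<forall>x\<in>S. \<forall>y\<in>S. \<bar>f x - f y\<bar> \<le> L * vec_norm2 (x - y))"

text \<open>
  A state-action pair is the concatenated vector \<open>x @\<^sub>v u\<close>, whose Euclidean norm satisfies
  \<open>\<parallel>(x,u)\<parallel>\<^sup>2 = \<parallel>x\<parallel>\<^sup>2 + \<parallel>u\<parallel>\<^sup>2\<close>; a cost is a function of it.  Rounds are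
  numbered from 1, and \<open>c t\<close>, \<open>w t\<close> are the cost and the disturbance realized in round \<open>t\<close>.

  A causal policy maps its own current state and the list of the pairs (cost, disturbance)
  revealed so far, in chronological order, to an action.
\<close>

type_synonym cost = "real vec \<Rightarrow> real"
type_synonym policy = "real vec \<Rightarrow> (cost \<times> real vec) list \<Rightarrow> real vec"

definition revealed :: "(nat \<Rightarrow> cost) \<Rightarrow> (nat \<Rightarrow> real vec) \<Rightarrow> nat \<Rightarrow> (cost \<times> real vec) list" where
  "revealed c w t = map (\<lambda>s. (c s, w s)) [1..<t]"

definition causal_policy :: "nat \<Rightarrow> nat \<Rightarrow> policy \<Rightarrow> bool" where
  "causal_policy dx du \<pi> \<longleftrightarrow>
     (\<forall>x h. x \<in> carrier_vec dx \<and> snd ` set h \<subseteq> carrier_vec dx \<longrightarrow> \<pi> x h \<in> carrier_vec du)"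

text \<open>The value of the counterfactual state in the (non-existing) round 0 is a dummy.\<close>

primrec cf_state ::
  "real mat \<Rightarrow> real mat \<Rightarrow> (nat \<Rightarrow> cost) \<Rightarrow> (nat \<Rightarrow> real vec) \<Rightarrow> policy \<Rightarrow> nat \<Rightarrow> real vec" where
  "cf_state A B c w \<pi> 0 = 0\<^sub>v (dim_row A)"
| "cf_state A B c w \<pi> (Suc t) =
     (if t = 0 then 0\<^sub>v (dim_row A)
      else A *\<^sub>v cf_state A B c w \<pi> t
             + B *\<^sub>v \<pi> (cf_state A B c w \<pi> t) (revealed c w t) + w t)"

definition cf_action ::
  "real mat \<Rightarrow> real mat \<Rightarrow> (nat \<Rightarrow> cost) \<Rightarrow> (nat \<Rightarrow> real vec) \<Rightarrow> policy \<Rightarrow> nat \<Rightarrow> real vec" where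
  "cf_action A B c w \<pi> t = \<pi> (cf_state A B c w \<pi> t) (revealed c w t)"

definition cf_point ::
  "real mat \<Rightarrow> real mat \<Rightarrow> (nat \<Rightarrow> cost) \<Rightarrow> (nat \<Rightarrow> real vec) \<Rightarrow> policy \<Rightarrow> nat \<Rightarrow> real vec" where
  "cf_point A B c w \<pi> t = cf_state A B c w \<pi> t @\<^sub>v cf_action A B c w \<pi> t"

definition simulatable :: "real mat \<Rightarrow> real mat \<Rightarrow> policy \<Rightarrow> bool" where
  "simulatable A B \<pi> \<longleftrightarrow>
     (\<forall>t c c' w w'. (\<forall>s\<in>{1..t}. c s = c' s \<and> w s = w' s) \<longrightarrow>
        cf_state A B c w \<pi> (t + 1) = cf_state A B c' w' \<pi> (t + 1) \<and>
        cf_action A B c w \<pi> (t + 1) = cf_action A B c' w' \<pi> (t + 1))"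

text \<open>
  Since a policy is a deterministic function of its own state and the revealed history,
  simulatability is not a restriction here.
\<close>

lemma revealed_cong:
  assumes "\<forall>s\<in>{1..t}. c s = c' s \<and> w s = w' s"
  shows "revealed c w (Suc t) = revealed c' w' (Suc t)"
  using assms unfolding revealed_def by auto

lemma cf_state_cong:
  assumes "\<forall>s\<in>{1..t}. c s = c' s \<and> w s = w' s"
  shows "cf_state A B c w \<pi> (Suc t) = cf_state A B c' w' \<pi> (Suc t)"
  using assms
proof (induction t)
  case (Suc t)
  have "cf_state A B c w \<pi> (Suc t) = cf_state A B c' w' \<pi> (Suc t)"
    using Suc by simp
  moreover have "revealed c w (Suc t) = revealed c' w' (Suc t)"
    using Suc.prems by (intro revealed_cong) simp
  moreover have "w (Suc t) = w' (Suc t)"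
    using Suc.prems by simp
  ultimately show ?case
    unfolding cf_state.simps(2)[of A B c w \<pi> "Suc t"] cf_state.simps(2)[of A B c' w' \<pi> "Suc t"]
    by simp
qed simp

lemma simulatable_policy: "simulatable A B \<pi>"
  unfolding simulatable_def cf_action_def
  using cf_state_cong revealed_cong by (metis Suc_eq_plus1)

definition gibbs ::
  "real \<Rightarrow> real mat \<Rightarrow> real mat \<Rightarrow> (nat \<Rightarrow> cost) \<Rightarrow> (nat \<Rightarrow> real vec) \<Rightarrow> policy set \<Rightarrow> nat
    \<Rightarrow> policy \<Rightarrow> real" where
  "gibbs \<eta> A B c w \<P> t \<pi> =
     exp (- \<eta> * (\<Sum>s\<in>{1..<t}. c s (cf_point A B c w \<pi> s))) /
     (\<Sum>\<rho>\<in>\<P>. exp (- \<eta> * (\<Sum>s\<in>{1..<t}. c s (cf_point A B c w \<rho> s))))"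

definition mean_state ::
  "real \<Rightarrow> real mat \<Rightarrow> real mat \<Rightarrow> (nat \<Rightarrow> cost) \<Rightarrow> (nat \<Rightarrow> real vec) \<Rightarrow> policy set \<Rightarrow> nat
    \<Rightarrow> real vec" where
  "mean_state \<eta> A B c w \<P> t =
     finsum_vec TYPE(real) (dim_row A) (\<lambda>\<pi>. gibbs \<eta> A B c w \<P> t \<pi> \<cdot>\<^sub>v cf_state A B c w \<pi> t) \<P>"

definition mean_action ::
  "real \<Rightarrow> real mat \<Rightarrow> real mat \<Rightarrow> (nat \<Rightarrow> cost) \<Rightarrow> (nat \<Rightarrow> real vec) \<Rightarrow> policy set \<Rightarrow> nat
    \<Rightarrow> real vec" where
  "mean_action \<eta> A B c w \<P> t =
     finsum_vec TYPE(real) (dim_col B) (\<lambda>\<pi>. gibbs \<eta> A B c w \<P> t \<pi> \<cdot>\<^sub>v cf_action A B c w \<pi> t) \<P>"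

text \<open>
  The physical system over \<open>T\<close> rounds.  \<open>c\<close> and \<open>w\<close> are the realized choices
  of the (possibly adaptive) environment; every realization is admitted, which gives the pathwise
  reading.
\<close>

definition physical_run ::
  "nat \<Rightarrow> real mat \<Rightarrow> real mat \<Rightarrow> (nat \<Rightarrow> real vec) \<Rightarrow> (nat \<Rightarrow> real vec) \<Rightarrow> (nat \<Rightarrow> real vec)
    \<Rightarrow> bool" where
  "physical_run T A B w x u \<longleftrightarrow>
     x 1 = 0\<^sub>v (dim_row A) \<and>
     (\<forall>t\<in>{1..T}. x (t + 1) = A *\<^sub>v x t + B *\<^sub>v u t + w t)"

definition gibbs_tracking ::
  "real \<Rightarrow> nat \<Rightarrow> real mat \<Rightarrow> real mat \<Rightarrow> real mat \<Rightarrow> policy set \<Rightarrow> (nat \<Rightarrow> cost)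
    \<Rightarrow> (nat \<Rightarrow> real vec) \<Rightarrow> (nat \<Rightarrow> real vec) \<Rightarrow> (nat \<Rightarrow> real vec) \<Rightarrow> bool" where
  "gibbs_tracking \<eta> T A B K\<^sub>0 \<P> c w x u \<longleftrightarrow>
     (\<forall>t\<in>{1..T}. u t = mean_action \<eta> A B c w \<P> t
                        - K\<^sub>0 *\<^sub>v (x t - mean_state \<eta> A B c w \<P> t))"

definition regret ::
  "nat \<Rightarrow> real mat \<Rightarrow> real mat \<Rightarrow> policy set \<Rightarrow> (nat \<Rightarrow> cost) \<Rightarrow> (nat \<Rightarrow> real vec)
    \<Rightarrow> (nat \<Rightarrow> real vec) \<Rightarrow> (nat \<Rightarrow> real vec) \<Rightarrow> real" where
  "regret T A B \<P> c w x u =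
     (\<Sum>t\<in>{1..T}. c t (x t @\<^sub>v u t))
       - (INF \<pi>\<in>\<P>. \<Sum>t\<in>{1..T}. c t (cf_point A B c w \<pi> t))"

definition tracking_gain :: "real mat \<Rightarrow> real mat \<Rightarrow> real mat \<Rightarrow> ennreal" where
  "tracking_gain A B K\<^sub>0 =
     (\<Sum>r. ennreal (op_norm ((1\<^sub>m (dim_row A) @\<^sub>r (- K\<^sub>0)) * (A - B * K\<^sub>0) ^\<^sub>m r)))"

text \<open>The block matrix \<open>[A B]\<close>, as a four-block matrix whose lower blocks have no rows.\<close>

definition append_cols :: "real mat \<Rightarrow> real mat \<Rightarrow> real mat" where
  "append_cols A B = four_block_mat A B (0\<^sub>m 0 (dim_col A)) (0\<^sub>m 0 (dim_col B))"

definition Gamma_tr :: "real mat \<Rightarrow> real mat \<Rightarrow> real mat \<Rightarrow> real" where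
  "Gamma_tr A B K\<^sub>0 = 1 + enn2real (tracking_gain A B K\<^sub>0) * op_norm (append_cols A B)"

end

theory Submission
  imports Defs
begin

text \<open>
  By convexity the cost of the mean point \<open>(xm t, um t)\<close> is at most the Gibbs average of the
  counterfactual costs, so the mean trajectory has the regret of exponential weights,
  \<open>ln N / \<eta> + \<eta> (L \<Delta>)\<^sup>2 T\<close>.  The mean trajectory does not obey the dynamics, but fails to do so
  only because the weights move: the tracking error satisfies \<open>e (t + 1) = (A - B K) e t + [A B] d t\<close>,
  where \<open>d t\<close> is the change of the mean point under the change of the weights from round \<open>t\<close> to
  \<open>t + 1\<close>.  One step moves the weights by \<open>O(\<eta> L \<Delta>)\<close> in \<open>\<ell>\<^sub>1\<close>, so \<open>d t\<close> has norm
  \<open>O(\<eta> L \<Delta>\<^sup>2)\<close>, and unrolling the recursion costs the factor \<open>\<Lambda>(K) \<parallel>[A B]\<parallel> = \<Gamma> - 1\<close>.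
  The total \<open>ln N / \<eta> + O(\<eta> (L \<Delta>)\<^sup>2 \<Gamma> T)\<close> is balanced by the choice of \<open>\<eta>\<close>.
\<close>

section \<open>Exponential weights\<close>

text \<open>For negative \<open>x\<close> the claim is rewritten as
  \<open>1 \<le> exp (- x) * (1 + x + x\<^sup>2)\<close>, where the second-order Taylor lower bound
  for \<open>exp (- x)\<close> is available. The resulting product exceeds 1 by
  \<open>x\<^sup>2 / 2 * (1 - x + x\<^sup>2)\<close>.\<close>

lemma exp_le_quadratic:
  fixes x :: real
  assumes "\<bar>x\<bar> \<le> 1"
  shows "exp x \<le> 1 + x + x\<^sup>2"
proof (cases "0 \<le> x")
  case True
  then show ?thesis using assms exp_bound by auto
next
  case False
  have "1 \<le> exp (- x) * (1 + x + x\<^sup>2)"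
  proof -
    have "1 \<le> (1 + (- x)) * (1 + x + x\<^sup>2) + (- x) ^ 2 / 2 * (1 + x + x\<^sup>2)"
    proof -
      have "(1 + (- x)) * (1 + x + x\<^sup>2) + (- x) ^ 2 / 2 * (1 + x + x\<^sup>2)
          = 1 + x\<^sup>2 / 2 * ((1 - x) + x\<^sup>2)"
        by (simp add: power2_eq_square field_simps)
      moreover have "0 \<le> x\<^sup>2 / 2 * ((1 - x) + x\<^sup>2)" using False by simp
      ultimately show ?thesis by linarith
    qed
    also have "\<dots> = (1 + (- x) + (- x)\<^sup>2 / 2) * (1 + x + x\<^sup>2)" by (simp add: algebra_simps)
    also have "\<dots> \<le> exp (- x) * (1 + x + x\<^sup>2)"
    proof (rule mult_right_mono)
      show "1 + (- x) + (- x)\<^sup>2 / 2 \<le> exp (- x)"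
        using False by (intro exp_lower_Taylor_quadratic) simp
      show "0 \<le> 1 + x + x\<^sup>2" using assms by (simp add: abs_le_iff)
    qed
    finally show ?thesis .
  qed
  then show ?thesis by (simp add: exp_minus field_simps)
qed

text \<open>The weights of \<open>gibbs\<close> with an abstract loss table in place of the
  counterfactual costs, so that this section involves no dynamics. At \<open>t = 1\<close> the sums
  are empty, which gives the uniform prior.\<close>

definition exp_weights :: "real \<Rightarrow> (nat \<Rightarrow> 'a \<Rightarrow> real) \<Rightarrow> 'a set \<Rightarrow> nat \<Rightarrow> 'a \<Rightarrow> real" where
  "exp_weights \<eta> l P t i =
     exp (- \<eta> * (\<Sum>s\<in>{1..<t}. l s i)) / (\<Sum>j\<in>P. exp (- \<eta> * (\<Sum>s\<in>{1..<t}. l s j)))"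

lemma exp_weights_nonneg: "0 \<le> exp_weights \<eta> l P t i"
  by (simp add: exp_weights_def sum_nonneg)

lemma sum_exp_weights:
  assumes "finite P" "P \<noteq> {}"
  shows "(\<Sum>i\<in>P. exp_weights \<eta> l P t i) = 1"
proof -
  have "(\<Sum>j\<in>P. exp (- \<eta> * (\<Sum>s\<in>{1..<t}. l s j))) > 0"
    using assms by (intro sum_pos) auto
  then show ?thesis
    by (simp add: exp_weights_def flip: sum_divide_distrib)
qed

text \<open>The shift \<open>m\<close> cancels; it is later taken to be the mean loss, which makes the
  normalizer at least 1.\<close>
lemma exp_weights_Suc:
  assumes "finite P" "P \<noteq> {}" "1 \<le> t"
  shows "exp_weights \<eta> l P (Suc t) i =
    exp_weights \<eta> l P t i * exp (- \<eta> * (l t i - m)) /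
      (\<Sum>j\<in>P. exp_weights \<eta> l P t j * exp (- \<eta> * (l t j - m)))"
proof -
  define e where "e j = exp (- \<eta> * (\<Sum>s\<in>{1..<t}. l s j))" for j
  define Z where "Z = sum e P"
  have Z: "Z > 0" unfolding Z_def e_def using assms by (intro sum_pos) auto
  have w: "exp_weights \<eta> l P t j = e j / Z" for j
    unfolding exp_weights_def Z_def e_def ..
  \<comment> \<open>\<open>1 \<le> t\<close> splits round \<open>t\<close> off the sum. The factor
    \<open>exp (- \<eta> * m)\<close> does not depend on \<open>j\<close> and cancels in the
    quotient.\<close>
  have s: "exp (- \<eta> * (\<Sum>s\<in>{1..<Suc t}. l s j)) = e j * exp (- \<eta> * (l t j - m)) * exp (- \<eta> * m)" for j
    using assms(3) by (simp add: e_def algebra_simps flip: exp_add)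
  show ?thesis
    using Z unfolding exp_weights_def[of \<eta> l P "Suc t"] s w
    by (simp add: sum_distrib_right[symmetric] sum_divide_distrib[symmetric])
qed

text \<open>Deviations from the mean average to zero, so the linear term of the exponential
  disappears from \<open>S\<close>. The tangent bound then gives \<open>1 \<le> S\<close>, and the
  quadratic bound leaves only the squared deviations.\<close>

lemma exp_moment_bounds:
  fixes p l :: "'a \<Rightarrow> real"
  assumes p: "\<And>i. i \<in> P \<Longrightarrow> 0 \<le> p i" "sum p P = 1"
    and R: "\<And>i j. i \<in> P \<Longrightarrow> j \<in> P \<Longrightarrow> \<bar>l i - l j\<bar> \<le> R"
    and \<eta>: "0 \<le> \<eta>" "\<eta> * R \<le> 1"
  defines "m \<equiv> \<Sum>i\<in>P. p i * l i"
  defines "S \<equiv> \<Sum>i\<in>P. p i * exp (- \<eta> * (l i - m))"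
  shows "\<And>i. i \<in> P \<Longrightarrow> \<bar>l i - m\<bar> \<le> R" "1 \<le> S" "S \<le> 1 + (\<eta> * R)\<^sup>2"
proof -
  show dev: "\<bar>l i - m\<bar> \<le> R" if "i \<in> P" for i
  proof -
    have "l i - m = (\<Sum>j\<in>P. p j * (l i - l j))"
      using p(2) by (simp add: m_def right_diff_distrib sum_subtractf flip: sum_distrib_right)
    also have "\<bar>\<dots>\<bar> \<le> (\<Sum>j\<in>P. p j * R)"
      using p(1) R[OF that] by (intro order_trans[OF sum_abs] sum_mono)
        (simp add: abs_mult mult_left_mono)
    finally show ?thesis using p(2) by (simp flip: sum_distrib_right)
  qed
  have centered: "(\<Sum>i\<in>P. p i * (1 + - \<eta> * (l i - m))) = 1"
  proof -
    have "(\<Sum>i\<in>P. p i * (1 + - \<eta> * (l i - m)))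
        = (\<Sum>i\<in>P. p i) - \<eta> * ((\<Sum>i\<in>P. p i * l i) - (\<Sum>i\<in>P. p i) * m)"
      by (simp add: algebra_simps sum.distrib sum_subtractf sum_distrib_left)
    then show ?thesis using p(2) by (simp add: m_def)
  qed
  have small: "\<bar>- \<eta> * (l i - m)\<bar> \<le> \<eta> * R" if "i \<in> P" for i
    using dev[OF that] \<eta>(1) by (simp add: abs_mult mult_left_mono)
  show "1 \<le> S"
  proof -
    have "1 = (\<Sum>i\<in>P. p i * (1 + - \<eta> * (l i - m)))" using centered by simp
    also have "\<dots> \<le> S"
      unfolding S_def using p(1) by (intro sum_mono mult_left_mono exp_ge_add_one_self)
    finally show ?thesis .
  qed
  have "S \<le> (\<Sum>i\<in>P. p i * (1 + - \<eta> * (l i - m)) + p i * (\<eta> * R)\<^sup>2)"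
    unfolding S_def
  proof (rule sum_mono)
    fix i assume i: "i \<in> P"
    have "exp (- \<eta> * (l i - m)) \<le> 1 + - \<eta> * (l i - m) + (- \<eta> * (l i - m))\<^sup>2"
      using small[OF i] \<eta>(2) by (intro exp_le_quadratic) linarith
    also have "(- \<eta> * (l i - m))\<^sup>2 \<le> (\<eta> * R)\<^sup>2"
      using small[OF i] by (metis abs_ge_zero power2_abs power_mono)
    finally show "p i * exp (- \<eta> * (l i - m)) \<le> p i * (1 + - \<eta> * (l i - m)) + p i * (\<eta> * R)\<^sup>2"
      using p(1)[OF i] by (simp add: mult_left_mono flip: distrib_left)
  qed
  then show "S \<le> 1 + (\<eta> * R)\<^sup>2"
    using p(2) centered by (simp add: sum.distrib flip: sum_distrib_right)
qed

text \<open>One update multiplies \<open>p i\<close> by \<open>E / S\<close>, where \<open>E\<close>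
  is the exponential factor of \<open>i\<close> and \<open>S\<close> the normalizer. Both differ
  from 1 by \<open>O(\<eta> * R)\<close>, so each weight changes by a relative amount of that order,
  and summing against \<open>p\<close> keeps the bound. The constant 3 leaves slack.\<close>

lemma exp_weights_stability:
  fixes l :: "nat \<Rightarrow> 'a \<Rightarrow> real"
  assumes P: "finite P" "P \<noteq> {}" and t: "1 \<le> t"
    and R: "\<And>i j. i \<in> P \<Longrightarrow> j \<in> P \<Longrightarrow> \<bar>l t i - l t j\<bar> \<le> R"
    and \<eta>: "0 \<le> \<eta>" "\<eta> * R \<le> 1"
  shows "(\<Sum>i\<in>P. \<bar>exp_weights \<eta> l P (Suc t) i - exp_weights \<eta> l P t i\<bar>) \<le> 3 * (\<eta> * R)"
proof -
  define p where "p = exp_weights \<eta> l P t"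
  define m where "m = (\<Sum>i\<in>P. p i * l t i)"
  define S where "S = (\<Sum>i\<in>P. p i * exp (- \<eta> * (l t i - m)))"
  have p: "\<And>i. 0 \<le> p i" "sum p P = 1"
    using exp_weights_nonneg sum_exp_weights[OF P] unfolding p_def by auto
  have mom: "\<And>i. i \<in> P \<Longrightarrow> \<bar>l t i - m\<bar> \<le> R" "1 \<le> S" "S \<le> 1 + (\<eta> * R)\<^sup>2"
    unfolding S_def m_def using p R \<eta> by (intro exp_moment_bounds; simp)+
  have "0 \<le> R" using P R by force
  then have r0: "0 \<le> \<eta> * R" using \<eta> by simp
  then have r2: "(\<eta> * R)\<^sup>2 \<le> \<eta> * R" using \<eta>(2) by (simp add: power2_eq_square mult_left_le)
  have "\<bar>exp_weights \<eta> l P (Suc t) i - p i\<bar> \<le> p i * (3 * (\<eta> * R))" if i: "i \<in> P" for i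
  proof -
    define E where "E = exp (- \<eta> * (l t i - m))"
    have x: "\<bar>- \<eta> * (l t i - m)\<bar> \<le> \<eta> * R"
      using mom(1)[OF i] \<eta>(1) by (simp add: abs_mult mult_left_mono)
    have "E \<le> 1 + - \<eta> * (l t i - m) + (- \<eta> * (l t i - m))\<^sup>2"
      unfolding E_def using x \<eta>(2) by (intro exp_le_quadratic) linarith
    moreover have "(- \<eta> * (l t i - m))\<^sup>2 \<le> (\<eta> * R)\<^sup>2"
      using x by (metis abs_ge_zero power2_abs power_mono)
    moreover have "1 + - \<eta> * (l t i - m) \<le> E" unfolding E_def by (rule exp_ge_add_one_self)
    ultimately have E: "\<bar>E - S\<bar> \<le> 3 * (\<eta> * R)"
      using x r2 mom(2,3) by linarith
    have "exp_weights \<eta> l P (Suc t) i - p i = p i * ((E - S) / S)"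
      unfolding exp_weights_Suc[OF P t, where m = m] using mom(2)
      by (simp add: E_def S_def p_def field_simps)
    also have "\<bar>\<dots>\<bar> \<le> p i * \<bar>E - S\<bar>"
      using mom(2) p(1)[of i]
        mult_left_mono[of 1 S "p i * \<bar>E - S\<bar>"]
      by (simp add: abs_mult divide_le_eq)
    also have "\<dots> \<le> p i * (3 * (\<eta> * R))" using E p(1) by (intro mult_left_mono)
    finally show ?thesis .
  qed
  then have "(\<Sum>i\<in>P. \<bar>exp_weights \<eta> l P (Suc t) i - p i\<bar>) \<le> (\<Sum>i\<in>P. p i * (3 * (\<eta> * R)))"
    by (rule sum_mono)
  then show ?thesis using p(2) by (simp add: p_def flip: sum_distrib_right)
qed

text \<open>The potential is \<open>ln (Z t)\<close>. Each round lowers it by \<open>\<eta>\<close>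
  times the mean loss, up to an error \<open>(\<eta> * R)\<^sup>2\<close>. It starts at the
  logarithm of the number of experts and never falls below the contribution of \<open>k\<close>
  alone; comparing the two ends and dividing by \<open>\<eta>\<close> gives the claim.\<close>

lemma exp_weights_regret:
  fixes l :: "nat \<Rightarrow> 'a \<Rightarrow> real"
  assumes P: "finite P" "k \<in> P"
    and R: "\<And>t i j. t \<in> {1..T} \<Longrightarrow> i \<in> P \<Longrightarrow> j \<in> P \<Longrightarrow> \<bar>l t i - l t j\<bar> \<le> R"
    and \<eta>: "0 < \<eta>" "\<eta> * R \<le> 1"
  shows "(\<Sum>t\<in>{1..T}. \<Sum>i\<in>P. exp_weights \<eta> l P t i * l t i) - (\<Sum>t\<in>{1..T}. l t k)
    \<le> ln (real (card P)) / \<eta> + \<eta> * R\<^sup>2 * real T"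
proof -
  have Pne: "P \<noteq> {}" using P by auto
  define Z where "Z t = (\<Sum>j\<in>P. exp (- \<eta> * (\<Sum>s\<in>{1..<t}. l s j)))" for t
  define m where "m t = (\<Sum>i\<in>P. exp_weights \<eta> l P t i * l t i)" for t
  have Zpos: "Z t > 0" for t unfolding Z_def using P by (intro sum_pos) auto
  have step: "ln (Z (Suc t)) \<le> ln (Z t) - \<eta> * m t + (\<eta> * R)\<^sup>2" if t: "t \<in> {1..T}" for t
  proof -
    define S where "S = (\<Sum>i\<in>P. exp_weights \<eta> l P t i * exp (- \<eta> * (l t i - m t)))"
    have mom: "1 \<le> S" "S \<le> 1 + (\<eta> * R)\<^sup>2"
      unfolding S_def m_def
      using exp_weights_nonneg[of \<eta> l P t] sum_exp_weights[OF P(1) Pne] R[OF t] \<eta>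
      by (intro exp_moment_bounds(2,3); simp)+
    have "exp (- \<eta> * (\<Sum>s\<in>{1..<Suc t}. l s j))
        = Z t * exp (- \<eta> * m t) * (exp_weights \<eta> l P t j * exp (- \<eta> * (l t j - m t)))" for j
      using t Zpos[of t] unfolding exp_weights_def Z_def[symmetric]
      by (simp add: algebra_simps flip: exp_add)
    then have "Z (Suc t) = Z t * exp (- \<eta> * m t) * S"
      unfolding Z_def[of "Suc t"] S_def by (simp only: sum_distrib_left)
    also have "ln \<dots> = ln (Z t) - \<eta> * m t + ln S"
      using Zpos[of t] mom(1) by (simp add: ln_mult)
    also have "ln S \<le> (\<eta> * R)\<^sup>2"
      using mom ln_le_minus_one[of S] by linarith
    finally show ?thesis by simp
  qed
  \<comment> \<open>Telescoping is restricted to \<open>n \<le> T\<close> because the range bound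
    \<open>R\<close> holds only in these rounds.\<close>
  have "ln (Z (Suc n)) \<le> ln (Z 1) + (\<Sum>t\<in>{1..n}. - \<eta> * m t + (\<eta> * R)\<^sup>2)" if "n \<le> T" for n
    using that
  proof (induction n)
    case (Suc n)
    then show ?case using step[of "Suc n"] by simp
  qed simp
  moreover have "Z 1 = real (card P)" by (simp add: Z_def)
  ultimately have "ln (Z (Suc T)) \<le> ln (real (card P)) - \<eta> * (\<Sum>t\<in>{1..T}. m t) + real T * (\<eta> * R)\<^sup>2"
    using order_refl[of T] by (fastforce simp: sum.distrib sum_subtractf sum_distrib_left)
  moreover have "- \<eta> * (\<Sum>t\<in>{1..T}. l t k) \<le> ln (Z (Suc T))"
  proof -
    have "exp (- \<eta> * (\<Sum>t\<in>{1..T}. l t k)) \<le> Z (Suc T)"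
      unfolding Z_def atLeastLessThanSuc_atLeastAtMost using P by (intro member_le_sum) auto
    then show ?thesis using Zpos[of "Suc T"] by (simp add: ln_ge_iff)
  qed
  ultimately have "\<eta> * ((\<Sum>t\<in>{1..T}. m t) - (\<Sum>t\<in>{1..T}. l t k))
      \<le> ln (real (card P)) + real T * (\<eta> * R)\<^sup>2"
    by (simp add: right_diff_distrib)
  then have "(\<Sum>t\<in>{1..T}. m t) - (\<Sum>t\<in>{1..T}. l t k)
      \<le> (ln (real (card P)) + real T * (\<eta> * R)\<^sup>2) / \<eta>"
    using \<eta>(1) by (simp add: pos_le_divide_eq mult.commute)
  then show ?thesis
    using \<eta>(1) by (simp add: m_def add_divide_distrib power2_eq_square mult_ac)
qed

section \<open>Euclidean and operator norms, weighted means\<close>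

lemma vec_norm2_carrier: "v \<in> carrier_vec n \<Longrightarrow> vec_norm2 v = L2_set (\<lambda>i. v $ i) {..<n}"
  by (auto simp: vec_norm2_def)

lemma vec_norm2_nonneg [simp]: "0 \<le> vec_norm2 v"
  by (simp add: vec_norm2_def)

lemma vec_norm2_zero [simp]: "vec_norm2 (0\<^sub>v n) = 0"
  by (simp add: vec_norm2_def L2_set_0')

lemma vec_norm2_smult: "vec_norm2 (a \<cdot>\<^sub>v v) = \<bar>a\<bar> * vec_norm2 v"
  by (simp add: vec_norm2_def L2_set_def power_mult_distrib real_sqrt_mult flip: sum_distrib_left)

lemma vec_norm2_add_le:
  assumes "u \<in> carrier_vec n" "v \<in> carrier_vec n"
  shows "vec_norm2 (u + v) \<le> vec_norm2 u + vec_norm2 v"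
proof -
  have "vec_norm2 (u + v) = L2_set (\<lambda>i. u $ i + v $ i) {..<n}"
    using assms by (auto simp: vec_norm2_def L2_set_def intro!: sum.cong)
  then show ?thesis
    using assms L2_set_triangle_ineq[of "\<lambda>i. u $ i" "\<lambda>i. v $ i" "{..<n}"]
    by (simp add: vec_norm2_carrier)
qed

lemma vec_norm2_minus_commute:
  assumes "u \<in> carrier_vec n" "v \<in> carrier_vec n"
  shows "vec_norm2 (u - v) = vec_norm2 (v - u)"
  using assms by (auto simp: vec_norm2_def L2_set_def power2_commute intro!: sum.cong)

lemma vec_norm2_finsum_le:
  assumes "finite P" "\<And>i. i \<in> P \<Longrightarrow> f i \<in> carrier_vec n"
  shows "vec_norm2 (finsum_vec TYPE(real) n f P) \<le> (\<Sum>i\<in>P. vec_norm2 (f i))"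
  using assms
proof (induction P rule: finite_induct)
  case empty
  then show ?case by (simp add: finsum_vec_empty)
next
  case (insert a P)
  have "finsum_vec TYPE(real) n f (insert a P) = f a + finsum_vec TYPE(real) n f P"
    using insert by (intro finsum_vec_insert) auto
  moreover have "finsum_vec TYPE(real) n f P \<in> carrier_vec n"
    using insert by (intro finsum_vec_closed) auto
  ultimately have "vec_norm2 (finsum_vec TYPE(real) n f (insert a P))
      \<le> vec_norm2 (f a) + vec_norm2 (finsum_vec TYPE(real) n f P)"
    using insert.prems vec_norm2_add_le[of "f a" n "finsum_vec TYPE(real) n f P"] by simp
  then show ?case using insert by (simp add: order_trans)
qed

section \<open>Weighted means of vectors\<close>

text \<open>The weights are arbitrary reals: besides probability weights, differences of two weight
  vectors occur. The form is that of \<open>mean_state\<close> and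
  \<open>mean_action\<close>.\<close>

abbreviation vec_mix :: "nat \<Rightarrow> 'a set \<Rightarrow> ('a \<Rightarrow> real) \<Rightarrow> ('a \<Rightarrow> real vec) \<Rightarrow> real vec" where
  "vec_mix n P p f \<equiv> finsum_vec TYPE(real) n (\<lambda>i. p i \<cdot>\<^sub>v f i) P"

lemma vec_mix_carrier:
  assumes "\<And>i. i \<in> P \<Longrightarrow> f i \<in> carrier_vec n"
  shows "vec_mix n P p f \<in> carrier_vec n"
  using assms by (intro finsum_vec_closed) auto

lemma index_vec_mix:
  assumes "finite P" "\<And>i. i \<in> P \<Longrightarrow> f i \<in> carrier_vec n" "k < n"
  shows "vec_mix n P p f $ k = (\<Sum>i\<in>P. p i * f i $ k)"
proof -
  have "(p i \<cdot>\<^sub>v f i) $ k = p i * f i $ k" if "i \<in> P" for i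
    using assms(2)[OF that] assms(3) by simp
  then show ?thesis using assms by (subst index_finsum_vec) auto
qed

lemma vec_mix_cong:
  assumes "finite P" "\<And>i. i \<in> P \<Longrightarrow> f i \<in> carrier_vec n" "\<And>i. i \<in> P \<Longrightarrow> f i = g i"
  shows "vec_mix n P p f = vec_mix n P p g"
proof -
  have g: "g i \<in> carrier_vec n" if "i \<in> P" for i using assms(2,3) that by metis
  have car: "vec_mix n P p f \<in> carrier_vec n" "vec_mix n P p g \<in> carrier_vec n"
    using assms(2) g by (auto intro!: vec_mix_carrier)
  show ?thesis
  proof
    show "dim_vec (vec_mix n P p f) = dim_vec (vec_mix n P p g)" using car by simp
    fix k assume "k < dim_vec (vec_mix n P p g)"
    then have k: "k < n" using car by simp
    show "vec_mix n P p f $ k = vec_mix n P p g $ k"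
      using index_vec_mix[OF assms(1,2) k] index_vec_mix[OF assms(1) g k] assms(3) by simp
  qed
qed

text \<open>This joins the separately defined means of states and of actions into one mean of the
  points \<open>cf_point\<close>.\<close>

lemma vec_mix_append:
  assumes "finite P" "\<And>i. i \<in> P \<Longrightarrow> f i \<in> carrier_vec n" "\<And>i. i \<in> P \<Longrightarrow> g i \<in> carrier_vec m"
  shows "vec_mix (n + m) P p (\<lambda>i. f i @\<^sub>v g i) = vec_mix n P p f @\<^sub>v vec_mix m P p g"
proof
  have F: "vec_mix n P p f \<in> carrier_vec n" and G: "vec_mix m P p g \<in> carrier_vec m"
    and FG: "vec_mix (n + m) P p (\<lambda>i. f i @\<^sub>v g i) \<in> carrier_vec (n + m)"
    using assms by (auto intro!: vec_mix_carrier)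
  then show "dim_vec (vec_mix (n + m) P p (\<lambda>i. f i @\<^sub>v g i))
      = dim_vec (vec_mix n P p f @\<^sub>v vec_mix m P p g)" by simp
  fix k assume "k < dim_vec (vec_mix n P p f @\<^sub>v vec_mix m P p g)"
  then have k: "k < n + m" using F G by simp
  have "vec_mix (n + m) P p (\<lambda>i. f i @\<^sub>v g i) $ k = (\<Sum>i\<in>P. p i * (f i @\<^sub>v g i) $ k)"
    using assms k by (intro index_vec_mix) auto
  also have "\<dots> = (\<Sum>i\<in>P. p i * (if k < n then f i $ k else g i $ (k - n)))"
  proof (rule sum.cong)
    fix i assume "i \<in> P"
    then have "dim_vec (f i) = n" "dim_vec (g i) = m" using assms(2,3) by auto
    then show "p i * (f i @\<^sub>v g i) $ k = p i * (if k < n then f i $ k else g i $ (k - n))"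
      using k by simp
  qed simp
  also have "\<dots> = (vec_mix n P p f @\<^sub>v vec_mix m P p g) $ k"
    using assms k F G by (auto simp: carrier_vecD index_vec_mix)
  finally show "vec_mix (n + m) P p (\<lambda>i. f i @\<^sub>v g i) $ k = (vec_mix n P p f @\<^sub>v vec_mix m P p g) $ k" .
qed

lemma mult_mat_vec_mix:
  assumes "finite P" "M \<in> carrier_mat m n" "\<And>i. i \<in> P \<Longrightarrow> f i \<in> carrier_vec n"
  shows "M *\<^sub>v vec_mix n P p f = vec_mix m P p (\<lambda>i. M *\<^sub>v f i)"
  using assms(1,3)
proof (induction P rule: finite_induct)
  case empty
  then show ?case using assms(2) by (auto simp: finsum_vec_empty intro!: eq_vecI)
next
  case (insert a P)
  have "M *\<^sub>v vec_mix n (insert a P) p f = M *\<^sub>v (p a \<cdot>\<^sub>v f a + vec_mix n P p f)"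
    using insert by (subst finsum_vec_insert) auto
  also have "\<dots> = p a \<cdot>\<^sub>v (M *\<^sub>v f a) + M *\<^sub>v vec_mix n P p f"
    using insert assms(2) by (subst mult_add_distrib_mat_vec[of M m n])
      (auto intro!: vec_mix_carrier simp: mult_mat_vec)
  also have "\<dots> = p a \<cdot>\<^sub>v (M *\<^sub>v f a) + vec_mix m P p (\<lambda>i. M *\<^sub>v f i)"
    using insert by simp
  also have "\<dots> = vec_mix m (insert a P) p (\<lambda>i. M *\<^sub>v f i)"
    using insert assms(2) by (subst finsum_vec_insert) auto
  finally show ?case .
qed

text \<open>Total weight 1 lets a vector common to all members, later the disturbance of a round,
  pass unchanged through the mean.\<close>

lemma vec_mix_translate:
  assumes "finite P" "\<And>i. i \<in> P \<Longrightarrow> f i \<in> carrier_vec n" "w \<in> carrier_vec n" "sum p P = 1"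
  shows "vec_mix n P p (\<lambda>i. f i + w) = vec_mix n P p f + w"
proof
  have F: "vec_mix n P p f \<in> carrier_vec n" "vec_mix n P p (\<lambda>i. f i + w) \<in> carrier_vec n"
    using assms by (auto intro!: vec_mix_carrier)
  then show "dim_vec (vec_mix n P p (\<lambda>i. f i + w)) = dim_vec (vec_mix n P p f + w)"
    using assms by simp
  fix k assume "k < dim_vec (vec_mix n P p f + w)"
  then have k: "k < n" using assms(3) by simp
  have "vec_mix n P p (\<lambda>i. f i + w) $ k = (\<Sum>i\<in>P. p i * (f i + w) $ k)"
    using assms k by (intro index_vec_mix) auto
  also have "\<dots> = (\<Sum>i\<in>P. p i * f i $ k) + sum p P * w $ k"
    using assms(3) k by (simp add: distrib_left sum.distrib carrier_vecD sum_distrib_right)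
  also have "\<dots> = (vec_mix n P p f + w) $ k"
    using assms k F by (simp add: carrier_vecD index_vec_mix)
  finally show "vec_mix n P p (\<lambda>i. f i + w) $ k = (vec_mix n P p f + w) $ k" .
qed

text \<open>Subtracting a fixed \<open>f k\<close> from every \<open>f i\<close> does not change the difference, since
  the weights have equal total mass; so only the diameter of the family enters.\<close>
lemma vec_norm2_vec_mix_diff_le:
  assumes P: "finite P" "\<And>i. i \<in> P \<Longrightarrow> f i \<in> carrier_vec n" and pq: "sum p P = sum q P"
    and D: "\<And>i j. i \<in> P \<Longrightarrow> j \<in> P \<Longrightarrow> vec_norm2 (f i - f j) \<le> D"
  shows "vec_norm2 (vec_mix n P q f - vec_mix n P p f) \<le> D * (\<Sum>i\<in>P. \<bar>q i - p i\<bar>)"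
proof (cases "P = {}")
  case True
  then show ?thesis by (simp add: finsum_vec_empty)
next
  case False
  then obtain k where k: "k \<in> P" by auto
  have car: "vec_mix n P q f \<in> carrier_vec n" "vec_mix n P p f \<in> carrier_vec n"
    "vec_mix n P (\<lambda>i. q i - p i) (\<lambda>i. f i - f k) \<in> carrier_vec n"
    using P k by (auto intro!: vec_mix_carrier)
  have "vec_mix n P q f - vec_mix n P p f = vec_mix n P (\<lambda>i. q i - p i) (\<lambda>i. f i - f k)"
  proof
    show "dim_vec (vec_mix n P q f - vec_mix n P p f)
        = dim_vec (vec_mix n P (\<lambda>i. q i - p i) (\<lambda>i. f i - f k))"
      using car by simp
    fix j assume "j < dim_vec (vec_mix n P (\<lambda>i. q i - p i) (\<lambda>i. f i - f k))"
    then have j: "j < n" using car by simp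
    have "(vec_mix n P q f - vec_mix n P p f) $ j
        = (\<Sum>i\<in>P. q i * f i $ j) - (\<Sum>i\<in>P. p i * f i $ j) - (sum q P - sum p P) * f k $ j"
      using car j P pq by (simp add: carrier_vecD index_vec_mix)
    also have "\<dots> = (\<Sum>i\<in>P. (q i - p i) * (f i $ j - f k $ j))"
      by (simp add: algebra_simps sum_subtractf sum.distrib sum_distrib_right)
    also have "\<dots> = (\<Sum>i\<in>P. (q i - p i) * (f i - f k) $ j)"
      using P(2)[OF k] j by (simp add: carrier_vecD)
    also have "\<dots> = vec_mix n P (\<lambda>i. q i - p i) (\<lambda>i. f i - f k) $ j"
      using P k j by (subst index_vec_mix) auto
    finally show "(vec_mix n P q f - vec_mix n P p f) $ j
        = vec_mix n P (\<lambda>i. q i - p i) (\<lambda>i. f i - f k) $ j" .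
  qed
  also have "vec_norm2 \<dots> \<le> (\<Sum>i\<in>P. vec_norm2 ((q i - p i) \<cdot>\<^sub>v (f i - f k)))"
    using P k by (intro vec_norm2_finsum_le) auto
  also have "\<dots> \<le> (\<Sum>i\<in>P. D * \<bar>q i - p i\<bar>)"
  proof (rule sum_mono)
    fix i assume "i \<in> P"
    then show "vec_norm2 ((q i - p i) \<cdot>\<^sub>v (f i - f k)) \<le> D * \<bar>q i - p i\<bar>"
      using mult_left_mono[OF D[of i k], of "\<bar>q i - p i\<bar>"] k
      by (simp add: vec_norm2_smult mult.commute)
  qed
  finally show ?thesis by (simp add: sum_distrib_left)
qed

text \<open>Jensen's inequality from two-point convexity: one index is split off and the remaining
  weights are rescaled by their sum \<open>q\<close>, hence the induction with arbitrary
  \<open>p\<close>. Membership in \<open>S\<close> is proved along with it because the two-point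
  inequality applies only to points of \<open>S\<close>.\<close>

lemma vec_convex_on_vec_mix:
  assumes cvx: "vec_convex_on n S f" and "finite P"
    and "\<And>i. i \<in> P \<Longrightarrow> 0 \<le> p i" "sum p P = 1" "\<And>i. i \<in> P \<Longrightarrow> v i \<in> S"
  shows "vec_mix n P p v \<in> S \<and> f (vec_mix n P p v) \<le> (\<Sum>i\<in>P. p i * f (v i))"
  using assms(2-)
proof (induction P arbitrary: p rule: finite_induct)
  case empty
  then show ?case by simp
next
  case (insert a P)
  have S: "S \<subseteq> carrier_vec n" using cvx by (simp add: vec_convex_on_def vec_convex_def)
  define q where "q = sum p P"
  have q: "0 \<le> q" "p a + q = 1" using insert by (auto simp: q_def intro!: sum_nonneg)
  have va: "v a \<in> carrier_vec n" using insert.prems(3) S by auto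
  have vP: "v i \<in> carrier_vec n" if "i \<in> P" for i using insert.prems(3) S that by auto
  have mixc: "vec_mix n P q v \<in> carrier_vec n" for q using vP by (rule vec_mix_carrier)
  have ins: "vec_mix n (insert a P) p v = p a \<cdot>\<^sub>v v a + vec_mix n P p v"
    using insert va vP by (intro finsum_vec_insert) auto
  show ?case
  proof (cases "q = 0")
    case True
    then have p0: "\<And>i. i \<in> P \<Longrightarrow> p i = 0"
      using insert by (simp add: q_def sum_nonneg_eq_0_iff)
    have "vec_mix n P p v = 0\<^sub>v n"
      using mixc[of p] insert(1)
      by (intro eq_vecI) (auto simp: index_vec_mix vP p0)
    then have "vec_mix n (insert a P) p v = v a"
      unfolding ins using True q va by simp
    then show ?thesis using insert True q p0 by simp
  next
    case False
    then have q0: "q > 0" using q by simp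
    define r where "r i = p i / q" for i
    have r: "\<And>i. i \<in> P \<Longrightarrow> 0 \<le> r i" "sum r P = 1"
      using insert q0 by (auto simp: r_def q_def simp flip: sum_divide_distrib)
    have IH: "vec_mix n P r v \<in> S" "f (vec_mix n P r v) \<le> (\<Sum>i\<in>P. r i * f (v i))"
      using insert.IH[of r] r insert by auto
    have scale: "vec_mix n P p v = q \<cdot>\<^sub>v vec_mix n P r v"
    proof
      show "dim_vec (vec_mix n P p v) = dim_vec (q \<cdot>\<^sub>v vec_mix n P r v)"
        using mixc[of p] mixc[of r] by simp
      fix k assume "k < dim_vec (q \<cdot>\<^sub>v vec_mix n P r v)"
      then have k: "k < n" using IH S by auto
      then have "vec_mix n P p v $ k = (\<Sum>i\<in>P. q * (r i * v i $ k))"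
        using vP insert(1) q0 by (simp add: index_vec_mix r_def)
      also have "\<dots> = (q \<cdot>\<^sub>v vec_mix n P r v) $ k"
        using vP insert(1) k mixc[of r]
        by (simp add: index_vec_mix sum_distrib_left carrier_vecD)
      finally show "vec_mix n P p v $ k = (q \<cdot>\<^sub>v vec_mix n P r v) $ k" .
    qed
    have pa: "0 \<le> p a" "v a \<in> S" using insert by auto
    have "f (p a \<cdot>\<^sub>v v a + q \<cdot>\<^sub>v vec_mix n P r v) \<le> p a * f (v a) + q * f (vec_mix n P r v)"
      using cvx IH(1) pa q unfolding vec_convex_on_def by blast
    also have "q * f (vec_mix n P r v) \<le> q * (\<Sum>i\<in>P. r i * f (v i))"
      using IH(2) q(1) by (rule mult_left_mono)
    also have "q * (\<Sum>i\<in>P. r i * f (v i)) = (\<Sum>i\<in>P. p i * f (v i))"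
      using q0 by (simp add: sum_distrib_left r_def)
    finally have "f (vec_mix n (insert a P) p v) \<le> (\<Sum>i\<in>insert a P. p i * f (v i))"
      unfolding ins scale using insert(1,2) by simp
    moreover have "vec_mix n (insert a P) p v \<in> S"
      unfolding ins scale using cvx IH(1) pa q
      unfolding vec_convex_on_def vec_convex_def by blast
    ultimately show ?thesis by blast
  qed
qed

section \<open>The operator norm and linear recursions\<close>

text \<open>The real supremum in \<open>op_norm\<close> is an upper bound only of a bounded set. On
  the unit ball the coordinates are at most 1 in modulus, so the sum of all absolute entries of
  \<open>M\<close> is a crude bound.\<close>

lemma bdd_above_op_norm:
  "bdd_above ((\<lambda>v. vec_norm2 (M *\<^sub>v v)) ` {v \<in> carrier_vec (dim_col M). vec_norm2 v \<le> 1})"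
proof (rule bdd_aboveI2)
  fix v assume v: "v \<in> {v \<in> carrier_vec (dim_col M). vec_norm2 v \<le> 1}"
  have "vec_norm2 (M *\<^sub>v v) \<le> (\<Sum>i<dim_row M. \<bar>(M *\<^sub>v v) $ i\<bar>)"
    unfolding vec_norm2_def dim_mult_mat_vec by (rule L2_set_le_sum_abs)
  also have "\<dots> \<le> (\<Sum>i<dim_row M. \<Sum>j<dim_col M. \<bar>M $$ (i, j)\<bar>)"
  proof (rule sum_mono)
    fix i assume i: "i \<in> {..<dim_row M}"
    have "\<bar>v $ j\<bar> \<le> 1" if "j < dim_col M" for j
    proof -
      have "\<bar>v $ j\<bar> \<le> L2_set (\<lambda>j. \<bar>v $ j\<bar>) {..<dim_col M}"
        using that by (intro member_le_L2_set[where f = "\<lambda>j. \<bar>v $ j\<bar>"]) auto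
      also have "\<dots> = vec_norm2 v"
        using v by (simp add: vec_norm2_carrier[of v "dim_col M"] L2_set_def)
      finally show ?thesis using v by simp
    qed
    then have "(\<Sum>j<dim_col M. \<bar>M $$ (i, j) * v $ j\<bar>) \<le> (\<Sum>j<dim_col M. \<bar>M $$ (i, j)\<bar>)"
      by (intro sum_mono) (simp add: abs_mult mult_left_le)
    moreover have "(M *\<^sub>v v) $ i = (\<Sum>j<dim_col M. M $$ (i, j) * v $ j)"
      using i v by (auto simp: scalar_prod_def lessThan_atLeast0 intro!: sum.cong)
    ultimately show "\<bar>(M *\<^sub>v v) $ i\<bar> \<le> (\<Sum>j<dim_col M. \<bar>M $$ (i, j)\<bar>)"
      using sum_abs[of "\<lambda>j. M $$ (i, j) * v $ j" "{..<dim_col M}"] by linarith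
  qed
  finally show "vec_norm2 (M *\<^sub>v v) \<le> (\<Sum>i<dim_row M. \<Sum>j<dim_col M. \<bar>M $$ (i, j)\<bar>)" .
qed

lemma op_norm_nonneg: "0 \<le> op_norm M"
proof -
  have "0 \<le> vec_norm2 (M *\<^sub>v 0\<^sub>v (dim_col M))" by simp
  also have "\<dots> \<le> op_norm M"
    unfolding op_norm_def by (rule cSUP_upper[OF _ bdd_above_op_norm]) simp
  finally show ?thesis .
qed

lemma vec_norm2_mult_mat_vec_le:
  assumes "v \<in> carrier_vec (dim_col M)"
  shows "vec_norm2 (M *\<^sub>v v) \<le> op_norm M * vec_norm2 v"
proof (cases "vec_norm2 v = 0")
  case True
  then have "v = 0\<^sub>v (dim_col M)"
    using assms by (auto simp: vec_norm2_def L2_set_eq_0_iff intro!: eq_vecI)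
  then have "M *\<^sub>v v = 0\<^sub>v (dim_row M)" by (auto intro!: eq_vecI)
  then show ?thesis using True by simp
next
  case False
  then have pos: "vec_norm2 v > 0" using vec_norm2_nonneg[of v] by linarith
  have "vec_norm2 (M *\<^sub>v (inverse (vec_norm2 v) \<cdot>\<^sub>v v)) \<le> op_norm M"
    unfolding op_norm_def using assms pos
    by (intro cSUP_upper[OF _ bdd_above_op_norm]) (simp add: vec_norm2_smult)
  moreover have "M *\<^sub>v (inverse (vec_norm2 v) \<cdot>\<^sub>v v) = inverse (vec_norm2 v) \<cdot>\<^sub>v (M *\<^sub>v v)"
    using assms by (intro mult_mat_vec) auto
  ultimately show ?thesis using pos by (simp add: vec_norm2_smult field_simps)
qed

text \<open>Unrolled, \<open>e k\<close> is a sum of powers of \<open>F\<close> applied to earlier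
  inputs \<open>g\<close>. The products of \<open>M\<close> with powers of \<open>F\<close> are kept
  whole, since \<open>tracking_gain\<close> sums precisely their norms. The extra exponent
  \<open>r\<close> serves the induction: peeling off the last step turns it into
  \<open>Suc r\<close>.\<close>

lemma vec_norm2_linear_recursion_le:
  assumes F: "F \<in> carrier_mat n n" and M: "M \<in> carrier_mat m n"
    and e: "e 0 = 0\<^sub>v n" "\<And>k. k < K \<Longrightarrow> e (Suc k) = F *\<^sub>v e k + g k"
    and g: "\<And>k. k < K \<Longrightarrow> g k \<in> carrier_vec n" "\<And>k. k < K \<Longrightarrow> vec_norm2 (g k) \<le> b"
    and k: "k \<le> K"
  shows "vec_norm2 ((M * F ^\<^sub>m r) *\<^sub>v e k) \<le> (\<Sum>s<k. op_norm (M * F ^\<^sub>m (r + s))) * b"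
  using k
proof (induction k arbitrary: r)
  case 0
  have "(M * F ^\<^sub>m r) *\<^sub>v 0\<^sub>v n = 0\<^sub>v m" using F M by (auto intro!: eq_vecI)
  then show ?case by (simp add: e)
next
  case (Suc k)
  have Fp: "F ^\<^sub>m j \<in> carrier_mat n n" for j using F by simp
  have car: "e k \<in> carrier_vec n"
  proof (cases "k = 0")
    case False
    then obtain j where j: "k = Suc j" using not0_implies_Suc by blast
    have "g j \<in> carrier_vec n" "e k = F *\<^sub>v e j + g j"
      using e(2)[of j] g(1)[of j] Suc.prems j by simp_all
    then have "dim_vec (e k) = n" by simp
    then show ?thesis by (rule carrier_vecI)
  qed (simp add: e)
  have gk: "g k \<in> carrier_vec n" "vec_norm2 (g k) \<le> b" using g Suc.prems by auto
  have "(M * F ^\<^sub>m r) *\<^sub>v e (Suc k) = (M * F ^\<^sub>m r) *\<^sub>v (F *\<^sub>v e k) + (M * F ^\<^sub>m r) *\<^sub>v g k"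
    using e(2) Suc.prems car gk F M Fp
    by (simp add: mult_add_distrib_mat_vec[of "M * F ^\<^sub>m r" m n])
  also have "(M * F ^\<^sub>m r) *\<^sub>v (F *\<^sub>v e k) = (M * F ^\<^sub>m r * F) *\<^sub>v e k"
    using F M Fp[of r] car by (intro assoc_mult_mat_vec[symmetric, of _ m n _ n]) auto
  also have "M * F ^\<^sub>m r * F = M * F ^\<^sub>m Suc r"
    using assoc_mult_mat[OF M Fp F, of r] by simp
  finally have split: "(M * F ^\<^sub>m r) *\<^sub>v e (Suc k)
      = (M * F ^\<^sub>m Suc r) *\<^sub>v e k + (M * F ^\<^sub>m r) *\<^sub>v g k" .
  have "vec_norm2 ((M * F ^\<^sub>m r) *\<^sub>v e (Suc k))
      \<le> vec_norm2 ((M * F ^\<^sub>m Suc r) *\<^sub>v e k) + vec_norm2 ((M * F ^\<^sub>m r) *\<^sub>v g k)"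
    unfolding split using M by (intro vec_norm2_add_le[of _ m] carrier_vecI) auto
  also have "vec_norm2 ((M * F ^\<^sub>m r) *\<^sub>v g k) \<le> op_norm (M * F ^\<^sub>m r) * b"
  proof (rule order_trans)
    show "vec_norm2 ((M * F ^\<^sub>m r) *\<^sub>v g k) \<le> op_norm (M * F ^\<^sub>m r) * vec_norm2 (g k)"
      using gk(1) F by (intro vec_norm2_mult_mat_vec_le) simp
    show "op_norm (M * F ^\<^sub>m r) * vec_norm2 (g k) \<le> op_norm (M * F ^\<^sub>m r) * b"
      using gk(2) op_norm_nonneg by (rule mult_left_mono)
  qed
  also have "vec_norm2 ((M * F ^\<^sub>m Suc r) *\<^sub>v e k) \<le> (\<Sum>s<k. op_norm (M * F ^\<^sub>m (Suc r + s))) * b"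
    using Suc.IH[of "Suc r"] Suc.prems by simp
  finally show ?case
    \<comment> \<open>The new input \<open>g k\<close> supplies the summand \<open>s = 0\<close>;
      the induction hypothesis supplies the others, shifted by one.\<close>
    by (simp add: sum.lessThan_Suc_shift algebra_simps del: sum.lessThan_Suc pow_mat.simps(2))
qed

section \<open>Tracking the mean trajectory\<close>

text \<open>The lower blocks have no rows, so the second part of the block product has dimension
  0.\<close>

lemma append_cols_mult_vec:
  assumes "A \<in> carrier_mat n k" "B \<in> carrier_mat n m" "a \<in> carrier_vec k" "b \<in> carrier_vec m"
  shows "append_cols A B *\<^sub>v (a @\<^sub>v b) = A *\<^sub>v a + B *\<^sub>v b"
proof -
  have "append_cols A B *\<^sub>v (a @\<^sub>v b)
      = (A *\<^sub>v a + B *\<^sub>v b) @\<^sub>v (0\<^sub>m 0 k *\<^sub>v a + 0\<^sub>m 0 m *\<^sub>v b)"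
    unfolding append_cols_def using assms
    by (subst four_block_mat_mult_vec[of A n k B m _ 0]) auto
  also have "\<dots> = A *\<^sub>v a + B *\<^sub>v b" by (intro eq_vecI) auto
  finally show ?thesis .
qed

lemma append_cols_carrier:
  assumes "A \<in> carrier_mat n k" "B \<in> carrier_mat n m"
  shows "append_cols A B \<in> carrier_mat n (k + m)"
  using assms by (intro carrier_matI) (auto simp: append_cols_def)

lemma Gamma_tr_ge_1: "1 \<le> Gamma_tr A B K"
  using mult_nonneg_nonneg[OF enn2real_nonneg op_norm_nonneg] by (simp add: Gamma_tr_def)

text \<open>Partial sums are compared with the series in \<open>ennreal\<close> and only then moved
  to the reals. Finiteness matters there, as \<open>enn2real\<close> sends
  \<open>\<infinity>\<close> to 0.\<close>

lemma sum_op_norm_le_tracking_gain: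
  assumes "tracking_gain A B K < \<infinity>"
  shows "(\<Sum>r<n. op_norm ((1\<^sub>m (dim_row A) @\<^sub>r (- K)) * (A - B * K) ^\<^sub>m r))
    \<le> enn2real (tracking_gain A B K)"
proof -
  let ?o = "\<lambda>r. op_norm ((1\<^sub>m (dim_row A) @\<^sub>r (- K)) * (A - B * K) ^\<^sub>m r)"
  have "ennreal (sum ?o {..<n}) = (\<Sum>r<n. ennreal (?o r))"
    by (simp add: op_norm_nonneg sum_ennreal)
  also have "\<dots> \<le> tracking_gain A B K"
    unfolding tracking_gain_def by (rule sum_le_suminf) auto
  finally have "enn2real (ennreal (sum ?o {..<n})) \<le> enn2real (tracking_gain A B K)"
    using assms by (intro enn2real_mono) auto
  then show ?thesis by (simp add: op_norm_nonneg sum_nonneg)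
qed

declare cf_state.simps [simp del]

text \<open>The rate is any positive \<open>\<eta>\<close> with
  \<open>\<eta> * (L * \<Delta>) \<le> 1\<close>, the range of the exponential estimates, so that
  tuning it is kept for the end. The set \<open>H\<close> in \<open>cost\<close> will be the convex
  hull of the theorem.\<close>

locale tracking_run =
  fixes dx du :: nat and A B K :: "real mat" and \<P> :: "policy set" and T :: nat and L \<Delta> \<eta> :: real
    and c :: "nat \<Rightarrow> cost" and w x u :: "nat \<Rightarrow> real vec"
  assumes A: "A \<in> carrier_mat dx dx" and B: "B \<in> carrier_mat dx du" and K: "K \<in> carrier_mat du dx"
    and gain: "tracking_gain A B K < \<infinity>"
    and fin: "finite \<P>" and nonempty: "\<P> \<noteq> {}"
    and causal: "\<And>\<pi>. \<pi> \<in> \<P> \<Longrightarrow> causal_policy dx du \<pi>"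
    and w: "\<And>t. t \<in> {1..T} \<Longrightarrow> w t \<in> carrier_vec dx"
    and run: "physical_run T A B w x u"
    and tracking: "gibbs_tracking \<eta> T A B K \<P> c w x u"
    and init: "x 1 - mean_state \<eta> A B c w \<P> 1 = 0\<^sub>v dx"
    and diam: "\<And>t \<pi> \<pi>'. t \<in> {1..T} \<Longrightarrow> \<pi> \<in> \<P> \<Longrightarrow> \<pi>' \<in> \<P> \<Longrightarrow>
      vec_norm2 (cf_point A B c w \<pi> t - cf_point A B c w \<pi>' t) \<le> \<Delta>"
    and cost: "\<And>t. t \<in> {1..T} \<Longrightarrow> \<exists>H. insert (x t @\<^sub>v u t) ((\<lambda>\<pi>. cf_point A B c w \<pi> t) ` \<P>) \<subseteq> H
      \<and> vec_convex_on (dx + du) H (c t) \<and> vec_lipschitz_on L H (c t)"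
    and \<eta>_pos: "0 < \<eta>" and \<eta>_le: "\<eta> * (L * \<Delta>) \<le> 1"
begin

abbreviation "st \<equiv> cf_state A B c w"
abbreviation "act \<equiv> cf_action A B c w"
abbreviation "pt t \<pi> \<equiv> cf_point A B c w \<pi> t"
abbreviation "p \<equiv> gibbs \<eta> A B c w \<P>"
abbreviation "xm \<equiv> mean_state \<eta> A B c w \<P>"
abbreviation "um \<equiv> mean_action \<eta> A B c w \<P>"
abbreviation "err t \<equiv> x t - xm t"
abbreviation "loss t \<pi> \<equiv> c t (pt t \<pi>)"

lemma gibbs_eq_exp_weights: "p = exp_weights \<eta> loss \<P>"
  by (intro ext) (simp add: gibbs_def exp_weights_def)

lemma p_nonneg: "0 \<le> p t \<pi>"
  by (simp add: gibbs_eq_exp_weights exp_weights_nonneg)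

lemma sum_p: "sum (p t) \<P> = 1"
  by (simp add: gibbs_eq_exp_weights sum_exp_weights fin nonempty)

section \<open>Counterfactual, mean and physical trajectories\<close>

lemma st_Suc: "1 \<le> t \<Longrightarrow> st \<pi> (Suc t) = A *\<^sub>v st \<pi> t + B *\<^sub>v act \<pi> t + w t"
  by (simp add: cf_state.simps cf_action_def)

lemma st_carrier:
  assumes t: "t \<in> {1..Suc T}"
  shows "st \<pi> t \<in> carrier_vec dx"
proof (cases "t = 1")
  case True
  then show ?thesis using A by (simp add: cf_state.simps)
next
  case False
  then obtain s where s: "t = Suc s" "s \<in> {1..T}" using t by (cases t) auto
  then have "dim_vec (st \<pi> t) = dim_vec (w s)" by (simp add: st_Suc)
  then show ?thesis using w[OF s(2)] by (metis carrier_vecD carrier_vecI)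
qed

lemma act_carrier:
  assumes "t \<in> {1..Suc T}" "\<pi> \<in> \<P>"
  shows "act \<pi> t \<in> carrier_vec du"
proof -
  have "snd ` set (revealed c w t) \<subseteq> carrier_vec dx"
    using assms(1) w by (auto simp: revealed_def)
  then show ?thesis
    using causal[OF assms(2)] st_carrier[OF assms(1)]
    unfolding cf_action_def causal_policy_def by blast
qed

lemma pt_carrier: "t \<in> {1..Suc T} \<Longrightarrow> \<pi> \<in> \<P> \<Longrightarrow> pt t \<pi> \<in> carrier_vec (dx + du)"
  unfolding cf_point_def using st_carrier act_carrier by auto

lemma mean_state_eq: "xm t = vec_mix dx \<P> (p t) (\<lambda>\<pi>. st \<pi> t)"
  using A by (simp add: mean_state_def)

lemma mean_action_eq: "um t = vec_mix du \<P> (p t) (\<lambda>\<pi>. act \<pi> t)"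
  using B by (simp add: mean_action_def)

lemma mean_carrier:
  assumes "t \<in> {1..Suc T}"
  shows "xm t \<in> carrier_vec dx" "um t \<in> carrier_vec du"
  unfolding mean_state_eq mean_action_eq
  using st_carrier[OF assms] act_carrier[OF assms] by (auto intro!: vec_mix_carrier)

lemma mean_point_eq:
  assumes "t \<in> {1..Suc T}"
  shows "vec_mix (dx + du) \<P> (p t) (pt t) = xm t @\<^sub>v um t"
  unfolding mean_state_eq mean_action_eq cf_point_def
  using st_carrier[OF assms] act_carrier[OF assms] fin by (intro vec_mix_append) auto

lemma x_carrier:
  assumes t: "t \<in> {1..Suc T}"
  shows "x t \<in> carrier_vec dx"
proof (cases "t = 1")
  case True
  then show ?thesis using run A by (simp add: physical_run_def)
next
  case False
  then obtain s where s: "t = Suc s" "s \<in> {1..T}" using t by (cases t) auto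
  then have "dim_vec (x t) = dim_vec (w s)" using run by (simp add: physical_run_def)
  then show ?thesis using w[OF s(2)] by (metis carrier_vecD carrier_vecI)
qed

lemma u_eq: "t \<in> {1..T} \<Longrightarrow> u t = um t - K *\<^sub>v err t"
  using tracking by (simp add: gibbs_tracking_def)

lemma u_carrier: "t \<in> {1..T} \<Longrightarrow> u t \<in> carrier_vec du"
  using K by (intro carrier_vecI) (simp add: u_eq)

section \<open>Recursion for the tracking error\<close>

text \<open>The feedback law makes the action error \<open>- K *\<^sub>v err t\<close>. The matrix
  obtained is the left factor in the terms of \<open>tracking_gain\<close>.\<close>

lemma point_error:
  assumes t: "t \<in> {1..T}"
  shows "(x t @\<^sub>v u t) - (xm t @\<^sub>v um t) = (1\<^sub>m dx @\<^sub>r (- K)) *\<^sub>v err t"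
proof -
  have car: "x t \<in> carrier_vec dx" "xm t \<in> carrier_vec dx" "um t \<in> carrier_vec du"
    "u t \<in> carrier_vec du" "err t \<in> carrier_vec dx"
    using t x_carrier mean_carrier u_carrier by auto
  have "(1\<^sub>m dx @\<^sub>r (- K)) *\<^sub>v err t = (1\<^sub>m dx *\<^sub>v err t) @\<^sub>v ((- K) *\<^sub>v err t)"
    using K car by (intro mat_mult_append) auto
  also have "\<dots> = err t @\<^sub>v - (K *\<^sub>v err t)"
    using K car by simp
  also have "\<dots> = (x t @\<^sub>v u t) - (xm t @\<^sub>v um t)"
    using car K u_eq[OF t] by (intro eq_vecI) auto
  finally show ?thesis by simp
qed

text \<open>The dynamics are affine with a common disturbance, so they commute with a mean under
  fixed weights. The weights are those of round \<open>Suc t\<close> but the points those of round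
  \<open>t\<close>; this mismatch is the only deviation of the mean trajectory from the
  dynamics.\<close>

lemma mean_state_Suc:
  assumes t: "t \<in> {1..T}"
  shows "xm (Suc t) = append_cols A B *\<^sub>v vec_mix (dx + du) \<P> (p (Suc t)) (pt t) + w t"
proof -
  have AB: "append_cols A B \<in> carrier_mat dx (dx + du)" using A B by (rule append_cols_carrier)
  have step: "st \<pi> (Suc t) = append_cols A B *\<^sub>v pt t \<pi> + w t" if "\<pi> \<in> \<P>" for \<pi>
    unfolding cf_point_def
    using t that st_carrier[of t \<pi>] act_carrier[of t \<pi>] A B
    by (subst append_cols_mult_vec) (auto simp: st_Suc)
  have "xm (Suc t) = vec_mix dx \<P> (p (Suc t)) (\<lambda>\<pi>. append_cols A B *\<^sub>v pt t \<pi> + w t)"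
    unfolding mean_state_eq using fin
  proof (rule vec_mix_cong)
    show "st \<pi> (Suc t) \<in> carrier_vec dx" for \<pi> using t by (intro st_carrier) simp
  qed (rule step)
  also have "\<dots> = vec_mix dx \<P> (p (Suc t)) (\<lambda>\<pi>. append_cols A B *\<^sub>v pt t \<pi>) + w t"
    using fin w[OF t] sum_p AB t pt_carrier[of t]
    by (intro vec_mix_translate) (auto intro: mult_mat_vec_carrier)
  also have "vec_mix dx \<P> (p (Suc t)) (\<lambda>\<pi>. append_cols A B *\<^sub>v pt t \<pi>)
      = append_cols A B *\<^sub>v vec_mix (dx + du) \<P> (p (Suc t)) (pt t)"
    using mult_mat_vec_mix[OF fin AB, of "pt t" "p (Suc t)"] pt_carrier[of t] t by auto
  finally show ?thesis .
qed

text \<open>The feedback part of \<open>u t\<close> turns \<open>A\<close> into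
  \<open>A - B * K\<close>, and \<open>w t\<close> cancels between the physical and the mean state.
  What remains is the image under \<open>[A B]\<close> of the change of the mean caused by the
  reweighting.\<close>

lemma err_Suc:
  assumes t: "t \<in> {1..T}"
  shows "err (Suc t) = (A - B * K) *\<^sub>v err t + append_cols A B *\<^sub>v
    (vec_mix (dx + du) \<P> (p t) (pt t) - vec_mix (dx + du) \<P> (p (Suc t)) (pt t))"
proof -
  let ?z = "vec_mix (dx + du) \<P> (p (Suc t)) (pt t)"
  have AB: "append_cols A B \<in> carrier_mat dx (dx + du)" using A B by (rule append_cols_carrier)
  have car: "x t \<in> carrier_vec dx" "xm t \<in> carrier_vec dx" "um t \<in> carrier_vec du"
    "u t \<in> carrier_vec du" "err t \<in> carrier_vec dx" "w t \<in> carrier_vec dx"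
    using t x_carrier mean_carrier u_carrier w by auto
  have z: "?z \<in> carrier_vec (dx + du)"
    using pt_carrier[of t] t by (intro vec_mix_carrier) auto
  have 1: "append_cols A B *\<^sub>v (vec_mix (dx + du) \<P> (p t) (pt t) - ?z)
      = (A *\<^sub>v xm t + B *\<^sub>v um t) - append_cols A B *\<^sub>v ?z"
    using t car z A B AB mean_point_eq[of t]
    by (simp add: mult_minus_distrib_mat_vec[OF AB] append_cols_mult_vec)
  have 2: "(A - B * K) *\<^sub>v err t = (A *\<^sub>v x t - A *\<^sub>v xm t) - B *\<^sub>v (K *\<^sub>v err t)"
    using A B K car
    by (simp add: minus_mult_distrib_mat_vec[of A dx dx] mult_minus_distrib_mat_vec[OF A]
      assoc_mult_mat_vec[OF B K])
  have 3: "B *\<^sub>v u t = B *\<^sub>v um t - B *\<^sub>v (K *\<^sub>v err t)"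
    using B K car unfolding u_eq[OF t] by (intro mult_minus_distrib_mat_vec) auto
  have 4: "x (Suc t) = A *\<^sub>v x t + B *\<^sub>v u t + w t"
    using run t by (simp add: physical_run_def)
  show ?thesis
    unfolding 1 2 4 3 mean_state_Suc[OF t]
    using A B AB car(6) by (intro eq_vecI) auto
qed

section \<open>Size of the tracking error and the resulting regret\<close>

lemma L_nonneg: "1 \<le> T \<Longrightarrow> 0 \<le> L"
  using cost[of 1] by (auto simp: vec_lipschitz_on_def)

lemma \<Delta>_nonneg: "1 \<le> T \<Longrightarrow> 0 \<le> \<Delta>"
  using diam[of 1] nonempty vec_norm2_nonneg order_trans
  by (metis atLeastAtMost_iff ex_in_conv order_refl)

lemma loss_range:
  assumes t: "t \<in> {1..T}" and "\<pi> \<in> \<P>" "\<rho> \<in> \<P>"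
  shows "\<bar>loss t \<pi> - loss t \<rho>\<bar> \<le> L * \<Delta>"
proof -
  have "\<bar>loss t \<pi> - loss t \<rho>\<bar> \<le> L * vec_norm2 (pt t \<pi> - pt t \<rho>)"
    using cost[OF t] assms by (auto simp: vec_lipschitz_on_def)
  also have "\<dots> \<le> L * \<Delta>"
    using diam[OF assms] L_nonneg t by (intro mult_left_mono) auto
  finally show ?thesis .
qed

lemma point_error_le:
  assumes t: "t \<in> {1..T}"
  shows "L * vec_norm2 ((x t @\<^sub>v u t) - (xm t @\<^sub>v um t))
    \<le> 3 * (Gamma_tr A B K - 1) * \<eta> * (L * \<Delta>)\<^sup>2"
proof -
  have L: "0 \<le> L" and D: "0 \<le> \<Delta>" using L_nonneg \<Delta>_nonneg t by auto
  let ?M = "1\<^sub>m dx @\<^sub>r (- K)" and ?F = "A - B * K" and ?AB = "append_cols A B"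
  define g where "g k = ?AB *\<^sub>v (vec_mix (dx + du) \<P> (p (Suc k)) (pt (Suc k))
      - vec_mix (dx + du) \<P> (p (Suc (Suc k))) (pt (Suc k)))" for k
  \<comment> \<open>The factors are the norm of \<open>[A B]\<close>, the diameter of the points and
    the \<open>\<ell>\<^sub>1\<close> change of the weights from
    \<open>exp_weights_stability\<close>.\<close>
  define b where "b = op_norm ?AB * (\<Delta> * (3 * (\<eta> * (L * \<Delta>))))"
  have b: "0 \<le> b" using L D \<eta>_pos op_norm_nonneg by (simp add: b_def)
  have M: "?M \<in> carrier_mat (dx + du) dx" and F: "?F \<in> carrier_mat dx dx"
    and AB: "?AB \<in> carrier_mat dx (dx + du)"
    using A B K by (auto intro!: append_cols_carrier)
  have gc: "g k \<in> carrier_vec dx" for k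
    using AB by (intro carrier_vecI) (simp add: g_def)
  have gn: "vec_norm2 (g k) \<le> b" if k: "k < T" for k
  proof -
    let ?y = "vec_mix (dx + du) \<P> (p (Suc k)) (pt (Suc k))"
      and ?z = "vec_mix (dx + du) \<P> (p (Suc (Suc k))) (pt (Suc k))"
    have yz: "?y \<in> carrier_vec (dx + du)" "?z \<in> carrier_vec (dx + du)"
      using k pt_carrier[of "Suc k"] by (auto intro!: vec_mix_carrier)
    have "vec_norm2 (?y - ?z) = vec_norm2 (?z - ?y)"
      using yz by (rule vec_norm2_minus_commute)
    also have "\<dots> \<le> \<Delta> * (\<Sum>\<pi>\<in>\<P>. \<bar>p (Suc (Suc k)) \<pi> - p (Suc k) \<pi>\<bar>)"
      using k fin pt_carrier[of "Suc k"] sum_p diam[of "Suc k"]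
      by (intro vec_norm2_vec_mix_diff_le) auto
    also have "\<dots> \<le> \<Delta> * (3 * (\<eta> * (L * \<Delta>)))"
      unfolding gibbs_eq_exp_weights
      using k fin nonempty loss_range[of "Suc k"] \<eta>_pos \<eta>_le D
      by (intro mult_left_mono exp_weights_stability) auto
    finally have "vec_norm2 (?y - ?z) \<le> \<Delta> * (3 * (\<eta> * (L * \<Delta>)))" .
    then have "op_norm ?AB * vec_norm2 (?y - ?z) \<le> b"
      unfolding b_def by (intro mult_left_mono op_norm_nonneg)
    moreover have "vec_norm2 (g k) \<le> op_norm ?AB * vec_norm2 (?y - ?z)"
      unfolding g_def using yz AB by (intro vec_norm2_mult_mat_vec_le) auto
    ultimately show ?thesis by linarith
  qed
  \<comment> \<open>The recursion lemma counts from 0, the rounds from 1: its index \<open>k\<close>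
    stands for round \<open>Suc k\<close>, and its zero start is \<open>init\<close>.\<close>
  obtain n where n: "t = Suc n" "n < T" using t by (cases t) auto
  have "vec_norm2 ((?M * ?F ^\<^sub>m 0) *\<^sub>v err (Suc n)) \<le> (\<Sum>s<n. op_norm (?M * ?F ^\<^sub>m (0 + s))) * b"
  proof (rule vec_norm2_linear_recursion_le[where e = "\<lambda>k. err (Suc k)" and K = n])
    show "err (Suc (Suc k)) = ?F *\<^sub>v err (Suc k) + g k" if "k < n" for k
      unfolding g_def using that n by (intro err_Suc) simp
  qed (use F M gc gn n init in auto)
  moreover have "?M * ?F ^\<^sub>m 0 = ?M"
    using right_mult_one_mat[OF M] B by simp
  ultimately have "vec_norm2 ((x t @\<^sub>v u t) - (xm t @\<^sub>v um t))
      \<le> (\<Sum>s<n. op_norm (?M * ?F ^\<^sub>m s)) * b"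
    using point_error[OF t] n by simp
  also have "\<dots> \<le> enn2real (tracking_gain A B K) * b"
    using sum_op_norm_le_tracking_gain[OF gain, of n] A b by (intro mult_right_mono) auto
  finally have "L * vec_norm2 ((x t @\<^sub>v u t) - (xm t @\<^sub>v um t))
      \<le> L * (enn2real (tracking_gain A B K) * b)"
    using L by (rule mult_left_mono)
  \<comment> \<open>By definition the gain times \<open>op_norm ?AB\<close> is
    \<open>Gamma_tr A B K - 1\<close>.\<close>
  also have "\<dots> = 3 * (Gamma_tr A B K - 1) * \<eta> * (L * \<Delta>)\<^sup>2"
    by (simp add: b_def Gamma_tr_def power2_eq_square)
  finally show ?thesis .
qed

text \<open>Jensen's inequality bounds the cost at the mean point, and the Lipschitz property pays
  for the distance from there to the physical point. The mean point lies in \<open>H\<close> by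
  convexity.\<close>

lemma cost_le:
  assumes t: "t \<in> {1..T}"
  shows "c t (x t @\<^sub>v u t)
    \<le> (\<Sum>\<pi>\<in>\<P>. p t \<pi> * loss t \<pi>) + 3 * (Gamma_tr A B K - 1) * \<eta> * (L * \<Delta>)\<^sup>2"
proof -
  obtain H where H: "insert (x t @\<^sub>v u t) (pt t ` \<P>) \<subseteq> H"
    "vec_convex_on (dx + du) H (c t)" "vec_lipschitz_on L H (c t)"
    using cost[OF t] by blast
  have "vec_mix (dx + du) \<P> (p t) (pt t) \<in> H
      \<and> c t (vec_mix (dx + du) \<P> (p t) (pt t)) \<le> (\<Sum>\<pi>\<in>\<P>. p t \<pi> * loss t \<pi>)"
    using H(1) fin p_nonneg sum_p by (intro vec_convex_on_vec_mix[OF H(2)]) auto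
  then have m: "xm t @\<^sub>v um t \<in> H" "c t (xm t @\<^sub>v um t) \<le> (\<Sum>\<pi>\<in>\<P>. p t \<pi> * loss t \<pi>)"
    using mean_point_eq[of t] t by auto
  have "\<bar>c t (x t @\<^sub>v u t) - c t (xm t @\<^sub>v um t)\<bar>
      \<le> L * vec_norm2 ((x t @\<^sub>v u t) - (xm t @\<^sub>v um t))"
    using H(1,3) m(1) unfolding vec_lipschitz_on_def by blast
  then show ?thesis using m(2) point_error_le[OF t] by linarith
qed

text \<open>The tracking cost is the same in every case, so it is separated from the bound
  \<open>b\<close> for the weights, which is instantiated both by \<open>exp_weights_regret\<close>
  and by 0.\<close>

lemma regret_leI:
  assumes "\<And>\<pi>. \<pi> \<in> \<P> \<Longrightarrow>
    (\<Sum>t\<in>{1..T}. \<Sum>\<rho>\<in>\<P>. p t \<rho> * loss t \<rho>) - (\<Sum>t\<in>{1..T}. loss t \<pi>) \<le> b"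
  shows "regret T A B \<P> c w x u
    \<le> b + 3 * (Gamma_tr A B K - 1) * \<eta> * (L * \<Delta>)\<^sup>2 * real T"
proof -
  define d where "d = 3 * (Gamma_tr A B K - 1) * \<eta> * (L * \<Delta>)\<^sup>2"
  have "(\<Sum>t\<in>{1..T}. c t (x t @\<^sub>v u t)) \<le> (\<Sum>t\<in>{1..T}. (\<Sum>\<rho>\<in>\<P>. p t \<rho> * loss t \<rho>) + d)"
    unfolding d_def by (intro sum_mono cost_le)
  also have "\<dots> = (\<Sum>t\<in>{1..T}. \<Sum>\<rho>\<in>\<P>. p t \<rho> * loss t \<rho>) + d * real T"
    by (simp add: sum.distrib)
  finally have le: "(\<Sum>t\<in>{1..T}. c t (x t @\<^sub>v u t))
      \<le> (\<Sum>t\<in>{1..T}. \<Sum>\<rho>\<in>\<P>. p t \<rho> * loss t \<rho>) + d * real T" .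
  have "(\<Sum>t\<in>{1..T}. c t (x t @\<^sub>v u t)) - d * real T - b \<le> (INF \<pi>\<in>\<P>. \<Sum>t\<in>{1..T}. loss t \<pi>)"
    using nonempty
  proof (rule cINF_greatest)
    fix \<pi> assume "\<pi> \<in> \<P>"
    then show "(\<Sum>t\<in>{1..T}. c t (x t @\<^sub>v u t)) - d * real T - b \<le> (\<Sum>t\<in>{1..T}. loss t \<pi>)"
      using assms[of \<pi>] le by linarith
  qed
  then show ?thesis unfolding regret_def d_def by linarith
qed

lemma regret_le:
  "regret T A B \<P> c w x u
    \<le> ln (real (card \<P>)) / \<eta> + 3 * Gamma_tr A B K * \<eta> * (L * \<Delta>)\<^sup>2 * real T"
proof -
  have "regret T A B \<P> c w x u \<le> (ln (real (card \<P>)) / \<eta> + \<eta> * (L * \<Delta>)\<^sup>2 * real T)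
      + 3 * (Gamma_tr A B K - 1) * \<eta> * (L * \<Delta>)\<^sup>2 * real T"
    unfolding gibbs_eq_exp_weights
    using fin loss_range \<eta>_pos \<eta>_le
    by (intro regret_leI[unfolded gibbs_eq_exp_weights] exp_weights_regret) auto
  \<comment> \<open>The coefficients add up to \<open>1 + 3 * (Gamma_tr A B K - 1)\<close>, which is
    at most \<open>3 * Gamma_tr A B K\<close>.\<close>
  moreover have "0 \<le> \<eta> * (L * \<Delta>)\<^sup>2 * real T" using \<eta>_pos by simp
  ultimately show ?thesis by (simp add: algebra_simps)
qed

text \<open>If \<open>L \<Delta> = 0\<close>, the term \<open>ln N / \<eta>\<close> of \<open>regret_le\<close> has to disappear altogether.\<close>
lemma regret_nonpos:
  assumes "L * \<Delta> = 0"
  shows "regret T A B \<P> c w x u \<le> 0"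
proof -
  have "(\<Sum>\<rho>\<in>\<P>. p t \<rho> * loss t \<rho>) = loss t \<pi>" if "t \<in> {1..T}" "\<pi> \<in> \<P>" for t \<pi>
  proof -
    \<comment> \<open>A range of 0 makes all losses of a round equal, so every weighting yields the
      loss of \<open>\<pi>\<close>.\<close>
    have "(\<Sum>\<rho>\<in>\<P>. p t \<rho> * loss t \<rho>) = (\<Sum>\<rho>\<in>\<P>. p t \<rho> * loss t \<pi>)"
      using loss_range[OF that(1) _ that(2)] assms by (intro sum.cong) auto
    then show ?thesis using sum_p[of t] by (simp flip: sum_distrib_right)
  qed
  then have "regret T A B \<P> c w x u \<le> 0 + 3 * (Gamma_tr A B K - 1) * \<eta> * (L * \<Delta>)\<^sup>2 * real T"
    by (intro regret_leI) simp
  then show ?thesis using assms by simp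
qed

end

section \<open>The learning rate\<close>

text \<open>The square root balances \<open>ln N / \<eta>\<close> against
  \<open>G * \<eta> * (L * \<Delta>)\<^sup>2 * T\<close>, and the minimum with 1 enforces
  \<open>\<eta> * (L * \<Delta>) \<le> 1\<close>. The value 1 for \<open>L * \<Delta> = 0\<close> is
  an arbitrary positive choice.\<close>

definition learning_rate :: "real \<Rightarrow> real \<Rightarrow> real \<Rightarrow> nat \<Rightarrow> nat \<Rightarrow> real" where
  "learning_rate L \<Delta> G T N =
     (if L * \<Delta> = 0 then 1 else min 1 (sqrt (ln (real N) / (G * real T))) / (L * \<Delta>))"

lemma learning_rate_bounds:
  assumes "0 \<le> L" "0 \<le> \<Delta>" "1 \<le> G" "1 \<le> T" "2 \<le> N"
  shows "0 < learning_rate L \<Delta> G T N" "learning_rate L \<Delta> G T N * (L * \<Delta>) \<le> 1"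
proof -
  have "0 < sqrt (ln (real N) / (G * real T))" using assms by simp
  moreover have "0 < L * \<Delta>" if "L * \<Delta> \<noteq> 0" using that assms by (simp add: less_le)
  ultimately show "0 < learning_rate L \<Delta> G T N" "learning_rate L \<Delta> G T N * (L * \<Delta>) \<le> 1"
    by (simp_all add: learning_rate_def)
qed

text \<open>With \<open>a = G * T\<close> and \<open>s\<close> the uncapped rate,
  \<open>ln N = a * s\<^sup>2\<close>, and the square root in the claim is \<open>a * s\<close>. If
  \<open>s \<le> 1\<close>, then \<open>ln N / r\<close> equals \<open>a * s\<close>; otherwise the
  cap acts and it equals \<open>ln N\<close>, whence the additive logarithm. The factor 4 is 1 from
  this term plus 3 from the tracking term.\<close>

lemma learning_rate_tradeoff:
  assumes R: "0 < L * \<Delta>" and "1 \<le> G" "1 \<le> T" "2 \<le> N"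
  defines "\<eta> \<equiv> learning_rate L \<Delta> G T N"
  shows "ln (real N) / \<eta> + 3 * G * \<eta> * (L * \<Delta>)\<^sup>2 * real T
    \<le> 4 * L * \<Delta> * (sqrt (G * real T * ln (real N)) + ln (real N))"
proof -
  define a s r where "a = G * real T" and "s = sqrt (ln (real N) / a)" and "r = min 1 s"
  have a: "0 < a" using assms by (simp add: a_def)
  have lnN: "0 < ln (real N)" using assms by simp
  have s: "0 < s" "ln (real N) = a * s\<^sup>2" using a lnN by (simp_all add: s_def)
  have r: "0 < r" "r \<le> s" using s by (auto simp: r_def)
  have sq: "sqrt (a * ln (real N)) = a * s"
    using a s by (intro real_sqrt_unique) (auto simp: power_mult_distrib power2_eq_square)
  have \<eta>: "\<eta> = r / (L * \<Delta>)"
    using R unfolding \<eta>_def learning_rate_def r_def s_def a_def by auto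
  have "ln (real N) / r \<le> a * s + ln (real N)"
  proof (cases "s \<le> 1")
    case True
    then have "ln (real N) / r = a * s" using s by (simp add: r_def power2_eq_square)
    then show ?thesis using lnN by simp
  next
    case False
    then show ?thesis using a s by (simp add: r_def)
  qed
  moreover have "a * r \<le> a * s" using a r by simp
  ultimately have "ln (real N) / r + 3 * (a * r) \<le> 4 * (a * s + ln (real N))"
    using lnN a s by (smt (verit) mult_pos_pos)
  then have "(L * \<Delta>) * (ln (real N) / r + 3 * (a * r)) \<le> (L * \<Delta>) * (4 * (a * s + ln (real N)))"
    using R by (intro mult_left_mono) auto
  moreover have "ln (real N) / \<eta> + 3 * G * \<eta> * (L * \<Delta>)\<^sup>2 * real T
      = (L * \<Delta>) * (ln (real N) / r + 3 * (a * r))"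
    using R r by (simp add: \<eta> a_def power2_eq_square field_simps)
  ultimately show ?thesis unfolding a_def[symmetric] sq by (simp add: mult_ac)
qed

text \<open>Quantifying \<open>rate\<close> before the dimensions, the system and the class
  expresses that the learning rate depends only on its five arguments. The proof takes
  \<open>c\<^sub>0 = 1\<close>, \<open>C\<^sub>0 = 4\<close> and
  \<open>learning_rate\<close>.\<close>

theorem corollary4p2:
  shows "\<exists>c\<^sub>0>0. \<exists>C\<^sub>0>0. \<exists>rate :: real \<Rightarrow> real \<Rightarrow> real \<Rightarrow> nat \<Rightarrow> nat \<Rightarrow> real.
    (\<forall>L \<Delta> G T N. 0 \<le> L \<longrightarrow> 0 \<le> \<Delta> \<longrightarrow> 1 \<le> G \<longrightarrow> 1 \<le> T \<longrightarrow> 2 \<le> N \<longrightarrow>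
       0 < rate L \<Delta> G T N \<and> rate L \<Delta> G T N * L * \<Delta> \<le> c\<^sub>0) \<and>
    (\<forall>dx du (A :: real mat) (B :: real mat) (K\<^sub>0 :: real mat) (\<P> :: policy set) (N :: nat) (T :: nat)
       (W :: real) (L :: real) (\<Delta> :: real)
       (c :: nat \<Rightarrow> cost) (w :: nat \<Rightarrow> real vec) (x :: nat \<Rightarrow> real vec) (u :: nat \<Rightarrow> real vec) (\<eta> :: real).
       A \<in> carrier_mat dx dx \<longrightarrow>
       B \<in> carrier_mat dx du \<longrightarrow>
       K\<^sub>0 \<in> carrier_mat du dx \<longrightarrow>
       tracking_gain A B K\<^sub>0 < \<infinity> \<longrightarrow>
       finite \<P> \<longrightarrow> card \<P> = N \<longrightarrow> 2 \<le> N \<longrightarrow>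
       (\<forall>\<pi>\<in>\<P>. causal_policy dx du \<pi> \<and> simulatable A B \<pi>) \<longrightarrow>
       1 \<le> T \<longrightarrow>
       (\<forall>t\<in>{1..T}. w t \<in> carrier_vec dx \<and> vec_norm2 (w t) \<le> W) \<longrightarrow>
       \<eta> = rate L \<Delta> (Gamma_tr A B K\<^sub>0) T N \<longrightarrow>
       physical_run T A B w x u \<longrightarrow>
       gibbs_tracking \<eta> T A B K\<^sub>0 \<P> c w x u \<longrightarrow>
       x 1 - mean_state \<eta> A B c w \<P> 1 = 0\<^sub>v dx \<longrightarrow>
       (\<forall>t\<in>{1..T}. \<forall>\<pi>\<in>\<P>. \<forall>\<pi>'\<in>\<P>.
          vec_norm2 (cf_point A B c w \<pi> t - cf_point A B c w \<pi>' t) \<le> \<Delta>) \<longrightarrow>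
       (\<forall>t\<in>{1..T}.
          let H = vec_convex_hull (dx + du)
                    (insert (x t @\<^sub>v u t) ((\<lambda>\<pi>. cf_point A B c w \<pi> t) ` \<P>))
          in vec_convex_on (dx + du) H (c t) \<and> vec_lipschitz_on L H (c t)) \<longrightarrow>
       regret T A B \<P> c w x u
         \<le> C\<^sub>0 * L * \<Delta> * (sqrt (Gamma_tr A B K\<^sub>0 * real T * ln (real N)) + ln (real N)))"
proof -
  have rate: "0 < learning_rate L \<Delta> G T N \<and> learning_rate L \<Delta> G T N * L * \<Delta> \<le> 1"
    if "0 \<le> L" "0 \<le> \<Delta>" "1 \<le> G" "1 \<le> T" "2 \<le> N" for L \<Delta> G T N
    using learning_rate_bounds[OF that] by (simp add: mult.assoc)
  have bound: "regret T A B \<P> c w x u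
      \<le> 4 * L * \<Delta> * (sqrt (Gamma_tr A B K * real T * ln (real N)) + ln (real N))"
    if AB: "A \<in> carrier_mat dx dx" "B \<in> carrier_mat dx du" "K \<in> carrier_mat du dx"
      and gain: "tracking_gain A B K < \<infinity>"
      and P: "finite \<P>" "card \<P> = N" "2 \<le> N"
      and causal: "\<forall>\<pi>\<in>\<P>. causal_policy dx du \<pi> \<and> simulatable A B \<pi>"
      and T: "1 \<le> T"
      and w: "\<forall>t\<in>{1..T}. w t \<in> carrier_vec dx \<and> vec_norm2 (w t) \<le> W"
      and \<eta>: "\<eta> = learning_rate L \<Delta> (Gamma_tr A B K) T N"
      and run: "physical_run T A B w x u" "gibbs_tracking \<eta> T A B K \<P> c w x u"
      and init: "x 1 - mean_state \<eta> A B c w \<P> 1 = 0\<^sub>v dx"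
      and diam: "\<forall>t\<in>{1..T}. \<forall>\<pi>\<in>\<P>. \<forall>\<pi>'\<in>\<P>.
          vec_norm2 (cf_point A B c w \<pi> t - cf_point A B c w \<pi>' t) \<le> \<Delta>"
      and cost: "\<forall>t\<in>{1..T}.
          let H = vec_convex_hull (dx + du)
                    (insert (x t @\<^sub>v u t) ((\<lambda>\<pi>. cf_point A B c w \<pi> t) ` \<P>))
          in vec_convex_on (dx + du) H (c t) \<and> vec_lipschitz_on L H (c t)"
    for dx du A B K \<P> N T W L \<Delta> c w x u \<eta>
  proof -
    have ne: "\<P> \<noteq> {}" using P by auto
    have cost': "\<exists>H. insert (x t @\<^sub>v u t) ((\<lambda>\<pi>. cf_point A B c w \<pi> t) ` \<P>) \<subseteq> H
        \<and> vec_convex_on (dx + du) H (c t) \<and> vec_lipschitz_on L H (c t)" if "t \<in> {1..T}" for t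
    proof (intro exI conjI)
      let ?H = "vec_convex_hull (dx + du) (insert (x t @\<^sub>v u t) ((\<lambda>\<pi>. cf_point A B c w \<pi> t) ` \<P>))"
      show "insert (x t @\<^sub>v u t) ((\<lambda>\<pi>. cf_point A B c w \<pi> t) ` \<P>) \<subseteq> ?H"
        unfolding vec_convex_hull_def by (rule hull_subset)
      show "vec_convex_on (dx + du) ?H (c t)" "vec_lipschitz_on L ?H (c t)"
        using bspec[OF cost that] by (simp_all only: Let_def)
    qed
    \<comment> \<open>Signs of \<open>L\<close> and \<open>\<Delta>\<close> are read off from round
      1: the first is part of the Lipschitz property, the second follows by comparing a policy with
      itself.\<close>
    have "1 \<in> {1..T}" using T by simp
    then have L: "0 \<le> L" using cost' unfolding vec_lipschitz_on_def by blast
    obtain \<pi> where "\<pi> \<in> \<P>" using ne by auto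
    then have "vec_norm2 (cf_point A B c w \<pi> 1 - cf_point A B c w \<pi> 1) \<le> \<Delta>"
      using diam T by auto
    then have D: "0 \<le> \<Delta>" using vec_norm2_nonneg order_trans by blast
    note lr = learning_rate_bounds[OF L D Gamma_tr_ge_1 T P(3), of A B K, folded \<eta>]
    have causal': "\<And>\<pi>. \<pi> \<in> \<P> \<Longrightarrow> causal_policy dx du \<pi>"
      and w': "\<And>t. t \<in> {1..T} \<Longrightarrow> w t \<in> carrier_vec dx"
      and diam': "\<And>t \<pi> \<pi>'. t \<in> {1..T} \<Longrightarrow> \<pi> \<in> \<P> \<Longrightarrow> \<pi>' \<in> \<P> \<Longrightarrow>
        vec_norm2 (cf_point A B c w \<pi> t - cf_point A B c w \<pi>' t) \<le> \<Delta>"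
      using causal w diam by blast+
    interpret tracking_run dx du A B K \<P> T L \<Delta> \<eta> c w x u
      by (rule tracking_run.intro) (fact AB gain P(1) ne causal' w' run init diam' cost' lr)+
    show ?thesis
    \<comment> \<open>In the degenerate case the right-hand side is 0, so the tradeoff, which
      divides by \<open>L * \<Delta>\<close>, is replaced by \<open>regret_nonpos\<close>.\<close>
    proof (cases "L * \<Delta> = 0")
      case True
      then show ?thesis using regret_nonpos[OF True] by auto
    next
      case False
      then have "0 < L * \<Delta>" using L D by (simp add: less_le)
      then show ?thesis
        using regret_le[unfolded P(2)] learning_rate_tradeoff[OF _ Gamma_tr_ge_1 T P(3), of L \<Delta> A B K]
        unfolding \<eta> by linarith
    qed
  qed
  show ?thesis
  proof (rule exI[of _ "1 :: real"], rule conjI, simp,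
      rule exI[of _ "4 :: real"], rule conjI, simp,
      rule exI[of _ learning_rate], rule conjI)
    show "\<forall>L \<Delta> G T N. 0 \<le> L \<longrightarrow> 0 \<le> \<Delta> \<longrightarrow> 1 \<le> G \<longrightarrow> 1 \<le> T \<longrightarrow> 2 \<le> N \<longrightarrow>
        0 < learning_rate L \<Delta> G T N \<and> learning_rate L \<Delta> G T N * L * \<Delta> \<le> 1"
      using rate by blast
  qed (intro allI impI, (rule bound; assumption))
qed

end
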